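(* Let $\mathfrak{g}$ be an infinite-dimensional Lie subalgebra of $W = \operatorname{Der}(\Bbbk[t,t^{-1}])$. Then either $\mathfrak{g}$ has finite codimension in $\operatorname{Ver}_n$ for some positive integer $n$, or there exists a non-constant $s \in \Bbbk[t,t^{-1}]$ such that $\mathfrak{g}$ has finite codimension in $L(s)$. In particular, $\mathfrak{g}$ is isomorphic to a Lie subalgebra of finite codimension in $W$ (in the first case) or in $\mathbb{W}_1$ (in the second case).
   Context: $\Bbbk$ is an algebraically closed field of characteristic zero; Lie algebras are over $\Bbbk$. The Witt algebra is $W = \operatorname{Der}_{\Bbbk}(\Bbbk[t,t^{-1}]) = \Bbbk[t,t^{-1}]\partial$ with $\partial = \frac{d}{dt}$, and it is viewed inside $\operatorname{Der}_{\Bbbk}(\Bbbk(t)) = \Bbbk(t)\partial$. The one-sided Witt algebra is $\mathbb{W}_1 = \operatorname{Der}_{\Bbbk}(\Bbbk[t]) = \Bbbk[t]\partial$. For non-constant $s \in \Bbbk[t,t^{-1}]$ with $s' = \frac{ds}{dt}$, the Lie algebra $\operatorname{Der}_{\Bbbk}(\Bbbk[s])$ is identified with the subalgebra $\frac{1}{s'}\Bbbk[s]\partial$ of $\Bbbk(t)\partial$, and $L(s) = W \cap \operatorname{Der}(\Bbbk[s])$, the intersection being taken in $\Bbbk(t)\partial$. For a positive integer $n$, $\operatorname{Ver}_n = \Bbbk[t^n,t^{-n}]\,t\partial$ is the $n$-Veronese subalgebra of $W$. "Has finite codimension in" means: is contained in, with finite-dimensional quotient vector space. *)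

theory Defs
  imports
    "HOL-Computational_Algebra.Computational_Algebra"
    "HOL-Library.Function_Algebras"
begin

section \<open>The field of rational functions and its derivations\<close>

type_synonym 'a ratfun = "'a poly fract"

definition ratconst :: "'a::field_char_0 \<Rightarrow> 'a ratfun" where
  "ratconst c = to_fract [:c:]"

definition ratvar :: "'a::field_char_0 ratfun" where
  "ratvar = to_fract [:0, 1:]"

lemma ratconst_0 [simp]: "ratconst 0 = 0"
  and ratconst_1 [simp]: "ratconst 1 = 1"
  by (simp_all add: ratconst_def flip: one_pCons)

lemma ratconst_add [simp]: "ratconst (a + b) = ratconst a + ratconst b"
  by (simp add: ratconst_def flip: to_fract_add)

lemma ratconst_mult [simp]: "ratconst (a * b) = ratconst a * ratconst b"
  by (simp add: ratconst_def flip: to_fract_mult)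

text \<open>Elements of the Lie algebra of derivations of the field of rational functions are represented
  by the operators themselves; sums and differences of operators are pointwise.\<close>

type_synonym 'a ratop = "'a ratfun \<Rightarrow> 'a ratfun"

definition derivation :: "'a::field_char_0 ratop \<Rightarrow> bool" where
  "derivation D \<longleftrightarrow>
     (\<forall>x y. D (x + y) = D x + D y) \<and>
     (\<forall>c x. D (ratconst c * x) = ratconst c * D x) \<and>
     (\<forall>x y. D (x * y) = D x * y + x * D y)"

text \<open>The quotient rule; the value does not depend on the chosen representation as a fraction, see
  \<open>ddt_Fract\<close> below.\<close>

definition ddt :: "'a::field_char_0 ratop" where
  "ddt x = (THE z. \<exists>p q. q \<noteq> 0 \<and> x = Fract p q \<and>
                      z = Fract (pderiv p * q - p * pderiv q) (q * q))"

lemma ddt_Fract: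
  fixes p q :: "'a::field_char_0 poly"
  assumes "q \<noteq> 0"
  shows "ddt (Fract p q) = Fract (pderiv p * q - p * pderiv q) (q * q)"
proof -
  have wd: "Fract (pderiv p * q - p * pderiv q) (q * q) = Fract (pderiv r * s - r * pderiv s) (s * s)"
    if eq: "Fract p q = Fract r s" and nz: "s \<noteq> 0" for r s
  proof -
    have eq: "p * s = r * q" using eq nz assms by (simp add: eq_fract)
    have "pderiv (p * s) = pderiv (r * q)" by (simp add: eq)
    hence d: "pderiv p * s + p * pderiv s = pderiv r * q + r * pderiv q"
      by (simp add: pderiv_mult algebra_simps)
    have "(pderiv p * q - p * pderiv q) * (s * s) - (pderiv r * s - r * pderiv s) * (q * q)
        = q * s * ((pderiv p * s + p * pderiv s) - (pderiv r * q + r * pderiv q))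
          - (p * s - r * q) * (q * pderiv s + s * pderiv q)"
      by (simp add: algebra_simps)
    hence "(pderiv p * q - p * pderiv q) * (s * s) = (pderiv r * s - r * pderiv s) * (q * q)"
      by (simp add: d eq)
    thus ?thesis using nz assms by (simp add: eq_fract)
  qed
  show ?thesis
    unfolding ddt_def
  proof (rule the_equality)
    fix z assume "\<exists>r s. s \<noteq> 0 \<and> Fract p q = Fract r s \<and>
                    z = Fract (pderiv r * s - r * pderiv s) (s * s)"
    then obtain r s where "s \<noteq> 0" "Fract p q = Fract r s"
      "z = Fract (pderiv r * s - r * pderiv s) (s * s)" by blast
    thus "z = Fract (pderiv p * q - p * pderiv q) (q * q)" using wd[of r s] by simp
  qed (use assms in blast)
qed

lemma ddt_to_fract: "ddt (to_fract p) = to_fract (pderiv p)"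
  by (simp add: to_fract_def ddt_Fract pderiv_1)

lemma ddt_ratvar [simp]: "ddt ratvar = 1"
  by (simp add: ratvar_def ddt_to_fract pderiv_pCons flip: one_pCons)

lemma ddt_ratconst [simp]: "ddt (ratconst c) = 0"
  by (simp add: ratconst_def ddt_to_fract pderiv_pCons)

lemma derivation_ddt: "derivation ddt"
proof -
  have add: "ddt (x + y) = ddt x + ddt y" for x y :: "'a ratfun"
  proof (cases x; cases y)
    fix p q r s :: "'a poly"
    assume *: "x = Fract p q" "q \<noteq> 0" "y = Fract r s" "s \<noteq> 0"
    show ?thesis using *(2,4)
      by (simp add: * ddt_Fract eq_fract pderiv_mult pderiv_add algebra_simps)
  qed
  have mult: "ddt (x * y) = ddt x * y + x * ddt y" for x y :: "'a ratfun"
  proof (cases x; cases y)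
    fix p q r s :: "'a poly"
    assume *: "x = Fract p q" "q \<noteq> 0" "y = Fract r s" "s \<noteq> 0"
    show ?thesis using *(2,4)
      by (simp add: * ddt_Fract eq_fract pderiv_mult pderiv_add algebra_simps)
  qed
  show ?thesis by (auto simp: derivation_def add mult)
qed

definition vf :: "'a::field_char_0 ratfun \<Rightarrow> 'a ratop" where
  "vf f = (\<lambda>x. f * ddt x)"

lemma derivation_vf: "derivation (vf f)"
  using derivation_ddt[where ?'a = 'a] by (auto simp: derivation_def vf_def algebra_simps)

lemma derivation_ratconst: assumes "derivation D" shows "D (ratconst c) = 0"
proof -
  have "D (1 * 1) = D 1 * 1 + 1 * D 1" using assms unfolding derivation_def by blast
  hence "D 1 = 0" by (metis add_cancel_right_right mult_1 mult_1_right)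
  moreover have "D (ratconst c * 1) = ratconst c * D 1" using assms unfolding derivation_def by blast
  ultimately show ?thesis by simp
qed

lemma derivation_eq_vf: assumes D: "derivation D" shows "D = vf (D ratvar)"
proof
  fix x :: "'a ratfun"
  note add = D[unfolded derivation_def, THEN conjunct1, rule_format]
  note mult = D[unfolded derivation_def, THEN conjunct2, THEN conjunct2, rule_format]
  have pol: "D (to_fract p) = D ratvar * ddt (to_fract p)" for p
  proof (induction p)
    case 0
    show ?case using derivation_ratconst[OF D, of 0] ddt_to_fract[of "0 :: 'a poly"] by simp
  next
    case (pCons a p)
    have e: "to_fract (pCons a p) = ratconst a + ratvar * to_fract p"
      by (simp add: ratconst_def ratvar_def flip: to_fract_add to_fract_mult)
    have dd: "derivation (ddt :: 'a ratop)" by (rule derivation_ddt)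
    note add' = dd[unfolded derivation_def, THEN conjunct1, rule_format]
    note mult' = dd[unfolded derivation_def, THEN conjunct2, THEN conjunct2, rule_format]
    show ?case
      by (simp add: e add mult add' mult' derivation_ratconst[OF D] pCons.IH algebra_simps)
  qed
  obtain p q where x: "x = Fract p q" and q: "q \<noteq> 0" by (cases x)
  have xq: "x * to_fract q = to_fract p" using q by (simp add: x to_fract_def eq_fract)
  have nz: "to_fract q \<noteq> 0" using q by simp
  note mult' = derivation_vf[of "D ratvar", unfolded derivation_def, THEN conjunct2, THEN conjunct2, rule_format]
  have "D (x * to_fract q) = vf (D ratvar) (x * to_fract q)"
    unfolding xq pol vf_def ..
  hence "D x * to_fract q + x * D (to_fract q)
       = vf (D ratvar) x * to_fract q + x * vf (D ratvar) (to_fract q)"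
    unfolding mult mult' .
  hence "D x * to_fract q = vf (D ratvar) x * to_fract q" by (simp add: pol vf_def)
  with nz show "D x = vf (D ratvar) x" by simp
qed

lemma derivations_eq_range_vf: "{D. derivation D} = range vf"
  using derivation_vf derivation_eq_vf by blast


section \<open>Linear algebra and Lie algebras of operators\<close>

definition ratop_scale :: "'a::field_char_0 \<Rightarrow> 'a ratop \<Rightarrow> 'a ratop" where
  "ratop_scale c D = (\<lambda>x. ratconst c * D x)"

global_interpretation ratop: vector_space "ratop_scale :: 'a::field_char_0 \<Rightarrow> 'a ratop \<Rightarrow> 'a ratop"
  by unfold_locales (auto simp: ratop_scale_def fun_eq_iff algebra_simps)

definition lie_bracket :: "'a::field_char_0 ratop \<Rightarrow> 'a ratop \<Rightarrow> 'a ratop" where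
  "lie_bracket D E = (D \<circ> E) - (E \<circ> D)"

lemma lie_bracket_vf: "lie_bracket (vf f) (vf g) = vf (f * ddt g - g * ddt f)"
proof
  fix x :: "'a ratfun"
  have mult: "ddt (x * y) = ddt x * y + x * ddt y" for x y :: "'a ratfun"
    using derivation_ddt unfolding derivation_def by blast
  show "lie_bracket (vf f) (vf g) x = vf (f * ddt g - g * ddt f) x"
  proof -
    have "lie_bracket (vf f) (vf g) x = f * ddt (g * ddt x) - g * ddt (f * ddt x)"
      by (simp add: lie_bracket_def vf_def)
    also have "\<dots> = (f * ddt g - g * ddt f) * ddt x"
      unfolding mult by (simp add: algebra_simps)
    finally show ?thesis by (simp add: vf_def)
  qed
qed

definition lie_subalgebra :: "'a::field_char_0 ratop set \<Rightarrow> 'a ratop set \<Rightarrow> bool" where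
  "lie_subalgebra h g \<longleftrightarrow>
     h \<subseteq> g \<and> ratop.subspace h \<and> (\<forall>D\<in>h. \<forall>E\<in>h. lie_bracket D E \<in> h)"

definition infinite_dimensional :: "'a::field_char_0 ratop set \<Rightarrow> bool" where
  "infinite_dimensional g \<longleftrightarrow> \<not> (\<exists>B. finite B \<and> g \<subseteq> ratop.span B)"

text \<open>The second conjunct says that the quotient \<open>g / h\<close> is spanned by the cosets of finitely many
  elements of \<open>g\<close>.\<close>

definition has_finite_codim_in :: "'a::field_char_0 ratop set \<Rightarrow> 'a ratop set \<Rightarrow> bool" where
  "has_finite_codim_in h g \<longleftrightarrow>
     h \<subseteq> g \<and> (\<exists>B. finite B \<and> B \<subseteq> g \<and> (\<forall>D\<in>g. \<exists>E\<in>ratop.span B. D - E \<in> h))"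

definition lie_isomorphic :: "'a::field_char_0 ratop set \<Rightarrow> 'a ratop set \<Rightarrow> bool" where
  "lie_isomorphic g h \<longleftrightarrow>
     (\<exists>\<phi>. bij_betw \<phi> g h \<and>
          (\<forall>D\<in>g. \<forall>E\<in>g. \<phi> (D + E) = \<phi> D + \<phi> E) \<and>
          (\<forall>c. \<forall>D\<in>g. \<phi> (ratop_scale c D) = ratop_scale c (\<phi> D)) \<and>
          (\<forall>D\<in>g. \<forall>E\<in>g. \<phi> (lie_bracket D E) = lie_bracket (\<phi> D) (\<phi> E)))"


section \<open>The Witt algebras and their subalgebras\<close>

inductive_set adjoin :: "'a::field_char_0 ratfun set \<Rightarrow> 'a ratfun set" for S where
  gen: "x \<in> S \<Longrightarrow> x \<in> adjoin S"
| const: "ratconst c \<in> adjoin S"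
| add: "x \<in> adjoin S \<Longrightarrow> y \<in> adjoin S \<Longrightarrow> x + y \<in> adjoin S"
| mult: "x \<in> adjoin S \<Longrightarrow> y \<in> adjoin S \<Longrightarrow> x * y \<in> adjoin S"

definition laurent :: "'a::field_char_0 ratfun set" where
  "laurent = adjoin {ratvar, inverse ratvar}"

definition witt :: "'a::field_char_0 ratop set" where
  "witt = vf ` laurent"

definition witt1 :: "'a::field_char_0 ratop set" where
  "witt1 = vf ` adjoin {ratvar}"

definition veronese :: "nat \<Rightarrow> 'a::field_char_0 ratop set" where
  "veronese n = {vf (f * ratvar) | f. f \<in> adjoin {ratvar ^ n, inverse (ratvar ^ n)}}"

definition der_adjoin :: "'a::field_char_0 ratfun \<Rightarrow> 'a ratop set" where
  "der_adjoin s = {vf (f / ddt s) | f. f \<in> adjoin {s}}"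

definition witt_sub :: "'a::field_char_0 ratfun \<Rightarrow> 'a ratop set" where
  "witt_sub s = witt \<inter> der_adjoin s"

text \<open>Inside the derivations of the rational function field, \<open>witt\<close>, \<open>witt1\<close> and, for non-constant
  \<open>s\<close>, \<open>der_adjoin s\<close> consist of those which preserve the ring of Laurent polynomials, the polynomial
  ring and the subalgebra generated by \<open>s\<close>, respectively.\<close>

lemma derivation_preserves_adjoin:
  assumes D: "derivation D"
  shows "D ` adjoin S \<subseteq> adjoin S \<longleftrightarrow> D ` S \<subseteq> adjoin S"
proof
  assume "D ` adjoin S \<subseteq> adjoin S" thus "D ` S \<subseteq> adjoin S" by (auto intro: adjoin.gen)
next
  assume S: "D ` S \<subseteq> adjoin S"
  have "D x \<in> adjoin S" if "x \<in> adjoin S" for x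
    using that
  proof induction
    case (const c)
    show ?case using adjoin.const[of 0 S] by (simp add: derivation_ratconst[OF D])
  next
    case (add x y) thus ?case using D by (auto simp: derivation_def intro: adjoin.add)
  next
    case (mult x y) thus ?case using D by (auto simp: derivation_def intro!: adjoin.add adjoin.mult)
  qed (use S in auto)
  thus "D ` adjoin S \<subseteq> adjoin S" by auto
qed

lemma ratvar_nz: "ratvar \<noteq> (0 :: 'a::field_char_0 ratfun)"
  by (simp add: ratvar_def)

lemma ddt_eq_0_iff: "ddt s = 0 \<longleftrightarrow> s \<in> range ratconst"
proof
  assume d: "ddt s = 0"
  have "Fract p q \<in> range ratconst"
    if "q \<noteq> 0" "ddt (Fract p q) = 0" for p q :: "'a poly"
    using that
  proof (induction "degree q" arbitrary: p q rule: less_induct)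
    case less
    have eq: "pderiv p * q = p * pderiv q"
      using less.prems by (simp add: ddt_Fract eq_fract Zero_fract_def)
    show ?case
    proof (cases "pderiv q = 0")
      case True
      with eq less.prems have "pderiv p = 0" by simp
      with True obtain a b where ab: "p = [:a:]" "q = [:b:]"
        by (metis degree_eq_zeroE pderiv_eq_0_iff)
      hence "Fract p q = ratconst (a / b)"
        using less.prems by (simp add: ratconst_def to_fract_def eq_fract)
      thus ?thesis by simp
    next
      case False
      hence "degree q \<noteq> 0" by (simp add: pderiv_eq_0_iff)
      hence "degree (pderiv q) < degree q" by (simp add: degree_pderiv)
      moreover have "Fract p q = Fract (pderiv p) (pderiv q)"
        using eq False less.prems by (simp add: eq_fract)
      ultimately show ?thesis using less.hyps[of "pderiv q" "pderiv p"] less.prems False by simp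
    qed
  qed
  thus "s \<in> range ratconst" using d by (cases s) auto
qed auto

lemma witt1_eq: "witt1 = {D. derivation D \<and> D ` adjoin {ratvar} \<subseteq> adjoin {ratvar}}"
proof (intro equalityI subsetI)
  fix D :: "'a ratop" assume "D \<in> witt1"
  then obtain f where "D = vf f" "f \<in> adjoin {ratvar}" by (auto simp: witt1_def)
  moreover from this have "D ` {ratvar} \<subseteq> adjoin {ratvar}" by (simp add: vf_def)
  ultimately show "D \<in> {D. derivation D \<and> D ` adjoin {ratvar} \<subseteq> adjoin {ratvar}}"
    using derivation_preserves_adjoin[of D] derivation_vf by blast
next
  fix D :: "'a ratop" assume "D \<in> {D. derivation D \<and> D ` adjoin {ratvar} \<subseteq> adjoin {ratvar}}"
  thus "D \<in> witt1"
    using derivation_eq_vf[of D] by (auto simp: derivation_preserves_adjoin witt1_def)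
qed

lemma ddt_inverse_ratvar: "ddt (inverse ratvar) = - (inverse ratvar * inverse ratvar)"
proof -
  have m: "ddt (x * y) = ddt x * y + x * ddt y" for x y :: "'a ratfun"
    using derivation_ddt unfolding derivation_def by blast
  have "ddt (ratvar * inverse ratvar :: 'a ratfun) = ddt (ratconst 1)"
    by (simp add: ratvar_nz)
  hence "inverse ratvar + ratvar * ddt (inverse ratvar :: 'a ratfun) = 0"
    unfolding m ddt_ratconst by simp
  thus ?thesis using ratvar_nz[where ?'a = 'a] by (simp add: field_simps eq_neg_iff_add_eq_0)
qed

lemma witt_eq: "witt = {D. derivation D \<and> D ` laurent \<subseteq> laurent}"
proof (intro equalityI subsetI)
  fix D :: "'a ratop" assume "D \<in> witt"
  then obtain f where f: "D = vf f" "f \<in> laurent" by (auto simp: witt_def)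
  have "vf f (inverse ratvar) = ratconst (-1) * (f * (inverse ratvar * inverse ratvar))"
  proof -
    have "ratconst (-1) = (- 1 :: 'a ratfun)"
      using ratconst_add[of "-1" "1::'a"] by (simp add: eq_neg_iff_add_eq_0)
    thus ?thesis by (simp add: vf_def ddt_inverse_ratvar)
  qed
  moreover have "\<dots> \<in> laurent"
    using f(2) unfolding laurent_def
    by (intro adjoin.mult adjoin.const) (auto intro: adjoin.gen)
  ultimately have "vf f (inverse ratvar) \<in> laurent" by simp
  thus "D \<in> {D. derivation D \<and> D ` laurent \<subseteq> laurent}"
    using f by (simp add: laurent_def derivation_preserves_adjoin derivation_vf) (simp add: vf_def)
next
  fix D :: "'a ratop" assume "D \<in> {D. derivation D \<and> D ` laurent \<subseteq> laurent}"
  thus "D \<in> witt"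
    using derivation_eq_vf[of D] by (auto simp: laurent_def derivation_preserves_adjoin witt_def)
qed

lemma der_adjoin_eq:
  assumes "s \<notin> range ratconst"
  shows "der_adjoin s = {D. derivation D \<and> D ` adjoin {s} \<subseteq> adjoin {s}}"
proof (intro equalityI subsetI)
  have nz: "ddt s \<noteq> 0" using assms by (simp add: ddt_eq_0_iff)
  {
    fix D :: "'a ratop" assume "D \<in> der_adjoin s"
    then obtain f where f: "D = vf (f / ddt s)" "f \<in> adjoin {s}" by (auto simp: der_adjoin_def)
    hence "D ` {s} \<subseteq> adjoin {s}" using nz by (simp add: vf_def)
    thus "D \<in> {D. derivation D \<and> D ` adjoin {s} \<subseteq> adjoin {s}}"
      using derivation_preserves_adjoin[of D] derivation_vf f(1) by blast
  next
    fix D :: "'a ratop" assume "D \<in> {D. derivation D \<and> D ` adjoin {s} \<subseteq> adjoin {s}}"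
    hence D: "derivation D" "D s \<in> adjoin {s}" by (auto simp: derivation_preserves_adjoin)
    have "D = vf (D ratvar)" by (rule derivation_eq_vf[OF D(1)])
    moreover from this have "D s = D ratvar * ddt s" by (metis vf_def)
    ultimately have "D = vf (D s / ddt s)" using nz by simp
    thus "D \<in> der_adjoin s" using D(2) by (auto simp: der_adjoin_def)
  }
qed

end

theory Submission
  imports Defs
begin

text \<open>
  Write \<open>V\<close> for the space of coefficients of the vector fields in the Lie algebra \<open>g\<close>, so that \<open>g\<close> consists of
  the \<open>f \<partial>\<close> with \<open>f\<close> in \<open>V\<close>, and let \<open>R\<close> be the ring of those Laurent polynomials \<open>a\<close> with \<open>a V \<subseteq> V\<close>
  (\<open>multipliers\<close>).  Everything rests on the fact that \<open>R\<close> is large.  For \<open>u, v, w, x\<close> in \<open>V\<close> the cyclic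
  sum of the iterated brackets \<open>[u, [[v, w], x]]\<close> is a differential operator of order zero in \<open>x\<close>, namely
  multiplication, up to sign, by twice the Wronskian of \<open>u, v, w\<close> (\<open>wronskian_identity\<close>), so \<open>R\<close> contains all Wronskians
  of elements of \<open>V\<close>.  If \<open>R\<close> contained constants only, then, for linearly independent \<open>u\<close> and \<open>v\<close>,
  \<open>w \<mapsto> Wr(u, v, w)\<close> would be a linear form on
  \<open>V\<close> with kernel spanned by \<open>u\<close> and \<open>v\<close>, and \<open>V\<close> would have dimension at most three; hence \<open>R\<close> has a
  non-constant element (\<open>nonconstant_multiplier\<close>).  Moreover \<open>a' f\<close> lies in \<open>R\<close> for \<open>a\<close> in \<open>R\<close> and \<open>f\<close> in \<open>V\<close>
  (\<open>multipliers_ddt\<close>).  Thus \<open>g\<close> acts by derivations on \<open>R\<close> and on its field of fractions \<open>K\<close>, and \<open>V\<close>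
  contains \<open>a' f\<^sup>2 R\<close>.

  By Lueroth's theorem \<open>K\<close> is generated by one element, which can be chosen to be a Laurent polynomial
  \<open>u\<close> (\<open>lueroth_laurent\<close>).  If \<open>u\<close> takes every value at a non-zero point, then the Laurent polynomials in \<open>K\<close>
  are the polynomials in \<open>u\<close>; otherwise \<open>u\<close> is, up to an affine change, a positive or
  negative power of the variable \<open>t\<close>, and the Laurent polynomials in \<open>K\<close> are the Laurent polynomials in some \<open>s = t\<^sup>n\<close>
  (\<open>laurent_subfield_cases\<close>).  In the first case put \<open>s = u\<close>.  For \<open>f\<close> in \<open>V\<close> the product \<open>f s'\<close> is a Laurent
  polynomial in \<open>K\<close>, which places \<open>g\<close> inside \<open>L(s)\<close> in the first case and inside \<open>Ver\<^sub>n\<close> in the second.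

  For the codimension, an element of \<open>K\<close> that is integral over \<open>R\<close> has powers with a common denominator
  in \<open>R\<close> (\<open>common_denominator\<close>).  So \<open>R\<close> contains a non-zero multiple of the ring of all polynomials in \<open>s\<close>,
  or of all Laurent polynomials in \<open>s\<close> if some element of \<open>R\<close> has poles both at zero and at infinity, and \<open>V\<close>
  inherits such a multiple.  In the second case without an element with both poles, \<open>R\<close> lies in the polynomials
  in \<open>s\<close> or in those in \<open>1 / s\<close>; a comparison of vanishing orders shows that \<open>g\<close> preserves this
  polynomial ring (\<open>no_pole\<close>), so that \<open>g\<close> lies in \<open>L(s)\<close> or \<open>L(1 / s)\<close> after all.

  For the isomorphisms, reading vector fields in the variable \<open>s\<close> (\<open>change_var\<close>) identifies \<open>W\<close> with \<open>Ver\<^sub>n\<close>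
  for \<open>s = t\<^sup>n\<close>, and \<open>W\<^sub>1\<close> with the derivations of the polynomial ring in \<open>s\<close> in general; in the latter
  algebra \<open>L(s)\<close> has finite codimension because some non-zero polynomial in \<open>s\<close> is divisible by \<open>s'\<close>.
\<close>

section \<open>Evaluation of polynomials at rational functions\<close>

lemma ddt_add: "ddt (x + y) = ddt x + ddt y"
  and ddt_mult: "ddt (x * y) = ddt x * y + x * ddt y"
  using derivation_ddt unfolding derivation_def by blast+

lemma ddt_0 [simp]: "ddt 0 = 0" and ddt_1 [simp]: "ddt 1 = 0"
  using ddt_ratconst[of 0] ddt_ratconst[of 1] by (simp_all del: ddt_ratconst)

lemma ddt_minus: "ddt (- x) = - ddt x"
  using ddt_add[of x "- x"] by (simp add: eq_neg_iff_add_eq_0 add.commute)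

lemma ddt_diff: "ddt (x - y) = ddt x - ddt y"
  using ddt_add[of x "- y"] by (simp add: ddt_minus)

lemma ddt_divide:
  assumes "y \<noteq> 0"
  shows "ddt (x / y) = (ddt x * y - x * ddt y) / (y * y)"
proof -
  have "ddt x = ddt (x / y * y)" using assms by simp
  also have "\<dots> = ddt (x / y) * y + x / y * ddt y" by (rule ddt_mult)
  finally show ?thesis using assms by (simp add: field_simps)
qed

lemma ddt_power: "ddt (x ^ n) = of_nat n * x ^ (n - 1) * ddt x"
proof (induction n)
  case (Suc n)
  then show ?case by (cases n) (simp_all add: ddt_mult algebra_simps)
qed simp

lemma ratconst_minus [simp]: "ratconst (- a) = - ratconst a"
  using ratconst_add[of a "- a"] by (simp add: eq_neg_iff_add_eq_0 add.commute del: ratconst_add)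

lemma ratconst_diff [simp]: "ratconst (a - b) = ratconst a - ratconst b"
  using ratconst_add[of a "- b"] by (simp del: ratconst_add)

lemma ratconst_eq_0_iff [simp]: "ratconst a = 0 \<longleftrightarrow> a = 0"
  by (simp add: ratconst_def)

lemma ratconst_of_nat [simp]: "ratconst (of_nat n) = of_nat n"
  by (induction n) (auto)

lemma ratconst_inverse [simp]: "ratconst (inverse a) = inverse (ratconst a)"
proof (cases "a = 0")
  case False
  then have "ratconst a * ratconst (inverse a) = 1"
    by (simp flip: ratconst_mult)
  then show ?thesis by (metis inverse_unique)
qed simp

lemma ratconst_divide [simp]: "ratconst (a / b) = ratconst a / ratconst b"
  by (simp add: divide_inverse)

lemma ratfun_of_nat_eq_0_iff [simp]: "(of_nat n :: 'a::field_char_0 ratfun) = 0 \<longleftrightarrow> n = 0"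
  using ratconst_eq_0_iff[of "of_nat n :: 'a"] by simp

declare ratvar_nz [simp]

text \<open>Application of a ring homomorphism to the coefficients of a polynomial.\<close>

lemma map_poly_hom_add:
  assumes "h 0 = 0" "\<And>a b. h (a + b) = h a + h b"
  shows "map_poly h (p + q) = map_poly h p + map_poly h q"
  by (rule poly_eqI) (simp add: assms coeff_map_poly)

lemma map_poly_hom_mult:
  fixes h :: "'b::comm_ring_1 \<Rightarrow> 'c::comm_ring_1"
  assumes "h 0 = 0" "\<And>a b. h (a + b) = h a + h b" "\<And>a b. h (a * b) = h a * h b"
  shows "map_poly h (p * q) = map_poly h p * map_poly h q"
proof -
  have "h (sum f A) = (\<Sum>x\<in>A. h (f x))" if "finite A" for f and A :: "nat set"
    using that by induction (simp_all add: assms)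
  then show ?thesis
    by (intro poly_eqI) (simp add: assms coeff_map_poly coeff_mult)
qed

text \<open>\<open>ev x p\<close> is the value at the rational function \<open>x\<close> of the polynomial \<open>p\<close> over the base field.\<close>

definition ev :: "'a::field_char_0 ratfun \<Rightarrow> 'a poly \<Rightarrow> 'a ratfun" where
  "ev x p = poly (map_poly ratconst p) x"

lemma ev_0 [simp]: "ev x 0 = 0"
  and ev_1 [simp]: "ev x 1 = 1"
  and ev_pCons [simp]: "ev x (pCons a p) = ratconst a + x * ev x p"
  by (simp_all add: ev_def map_poly_pCons map_poly_1)

lemma ev_add [simp]: "ev x (p + q) = ev x p + ev x q"
  by (simp add: ev_def map_poly_hom_add)

lemma ev_mult [simp]: "ev x (p * q) = ev x p * ev x q"
  by (simp add: ev_def map_poly_hom_mult)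

lemma ev_smult [simp]: "ev x (smult c p) = ratconst c * ev x p"
  using ev_mult[of x "[:c:]" p] by simp

lemma ev_minus [simp]: "ev x (- p) = - ev x p"
  using ev_add[of x p "- p"] by (simp add: eq_neg_iff_add_eq_0 add.commute del: ev_add)

lemma ev_diff [simp]: "ev x (p - q) = ev x p - ev x q"
  using ev_add[of x p "- q"] by (simp del: ev_add)

lemma ev_power [simp]: "ev x (p ^ n) = ev x p ^ n"
  by (induction n) auto

lemma ev_monom [simp]: "ev x (monom c n) = ratconst c * x ^ n"
  by (induction n) (simp_all add: monom_0 monom_Suc mult_ac)

lemma ev_ratvar: "ev ratvar p = to_fract p"
proof (induction p)
  case (pCons a p)
  have "to_fract (pCons a p) = to_fract ([:a:] + [:0, 1:] * p)"
    by simp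
  then show ?case
    unfolding to_fract_add to_fract_mult pCons.IH[symmetric]
    by (simp add: ratconst_def ratvar_def)
qed simp

lemma ddt_ev: "ddt (ev x p) = ev x (pderiv p) * ddt x"
  by (induction p) (simp_all add: ddt_add ddt_mult pderiv_pCons algebra_simps)

text \<open>In characteristic zero a non-constant rational function is transcendental: the derivative of
  a relation of minimal degree is a relation of smaller degree.\<close>

lemma ev_eq_0_iff:
  assumes "x \<notin> range ratconst"
  shows "ev x p = 0 \<longleftrightarrow> p = 0"
proof
  assume "ev x p = 0"
  then show "p = 0"
  proof (induction "degree p" arbitrary: p rule: less_induct)
    case less
    have "ev x (pderiv p) * ddt x = 0"
      using less.prems by (simp flip: ddt_ev)
    with assms have d: "ev x (pderiv p) = 0"
      by (simp add: ddt_eq_0_iff)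
    have "pderiv p = 0"
    proof (cases "degree p = 0")
      case False
      then have "degree (pderiv p) < degree p" by (simp add: degree_pderiv)
      then show ?thesis using less.hyps d by blast
    qed (simp add: pderiv_eq_0_iff)
    then obtain c where "p = [:c:]" by (metis degree_eq_zeroE pderiv_eq_0_iff)
    with less.prems show ?case by simp
  qed
qed simp

lemma ev_inject:
  assumes "x \<notin> range ratconst"
  shows "ev x p = ev x q \<longleftrightarrow> p = q"
  using ev_eq_0_iff[OF assms, of "p - q"] by simp

lemma ratvar_nonconst: "ratvar \<notin> range ratconst"
  by (metis ddt_eq_0_iff ddt_ratvar zero_neq_one)

lemma adjoin_power: "x \<in> adjoin S \<Longrightarrow> x ^ n \<in> adjoin S"
  by (induction n) (auto intro: adjoin.mult adjoin.const[of 1, simplified])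

lemma adjoin_minus: "x \<in> adjoin S \<Longrightarrow> - x \<in> adjoin S"
  using adjoin.mult[OF adjoin.const[of "-1"]] by simp

lemma adjoin_diff: "x \<in> adjoin S \<Longrightarrow> y \<in> adjoin S \<Longrightarrow> x - y \<in> adjoin S"
  using adjoin.add[OF _ adjoin_minus] by simp

lemma adjoin_0 [simp]: "0 \<in> adjoin S" and adjoin_1 [simp]: "1 \<in> adjoin S"
  using adjoin.const[of 0] adjoin.const[of 1] by simp_all

lemma ev_in_adjoin: "x \<in> adjoin S \<Longrightarrow> ev x p \<in> adjoin S"
  by (induction p) (auto intro: adjoin.intros)

lemma adjoin_single: "adjoin {x} = range (ev x)"
proof (intro equalityI subsetI)
  fix y assume "y \<in> adjoin {x}"
  then show "y \<in> range (ev x)"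
  proof induction
    case (gen y) then show ?case by (intro range_eqI[of _ _ "[:0, 1:]"]) simp
  next
    case (const c) then show ?case by (intro range_eqI[of _ _ "[:c:]"]) simp
  next
    case (add y z) then show ?case by (auto simp flip: ev_add)
  next
    case (mult y z) then show ?case by (auto simp flip: ev_mult)
  qed
qed (auto intro!: ev_in_adjoin[OF adjoin.gen])

lemma adjoin_inverse:
  assumes "x \<noteq> 0"
  shows "adjoin {x, inverse x} = {ev x p / x ^ m | p m. True}"
proof (intro equalityI subsetI)
  fix y assume "y \<in> adjoin {x, inverse x}"
  then show "y \<in> {ev x p / x ^ m | p m. True}"
  proof induction
    case (gen y)
    have "x = ev x [:0, 1:] / x ^ 0" "inverse x = ev x 1 / x ^ 1"
      by (simp_all add: inverse_eq_divide)
    with gen show ?case by blast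
  next
    case (const c)
    have "ratconst c = ev x [:c:] / x ^ 0" by simp
    then show ?case by blast
  next
    case (add y z)
    then obtain p m q n where yz: "y = ev x p / x ^ m" "z = ev x q / x ^ n" by blast
    have "y + z = ev x (p * monom 1 n + q * monom 1 m) / x ^ (m + n)"
      using assms unfolding yz by (simp add: add_divide_distrib power_add)
    then show ?case by blast
  next
    case (mult y z)
    then obtain p m q n where "y = ev x p / x ^ m" "z = ev x q / x ^ n" by blast
    then have "y * z = ev x (p * q) / x ^ (m + n)" by (simp add: power_add)
    then show ?case by blast
  qed
next
  fix y assume "y \<in> {ev x p / x ^ m | p m. True}"
  then obtain p m where y: "y = ev x p * inverse x ^ m" by (auto simp: field_simps)
  show "y \<in> adjoin {x, inverse x}"
    unfolding y by (intro adjoin.mult adjoin_power ev_in_adjoin) (auto intro: adjoin.gen)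
qed

text \<open>The numerator can be taken with non-zero constant term, unless there is no denominator.\<close>

lemma adjoin_inverse_cases:
  assumes "x \<noteq> 0" "y \<in> adjoin {x, inverse x}"
  obtains p m where "y = ev x p / x ^ m" "m = 0 \<or> coeff p 0 \<noteq> 0"
proof -
  have "\<exists>m p. y = ev x p / x ^ m"
    using assms(2) unfolding adjoin_inverse[OF assms(1)] by blast
  then obtain m p where p: "y = ev x p / x ^ m" and min: "\<And>n q. n < m \<Longrightarrow> y \<noteq> ev x q / x ^ n"
    using exists_least_iff[of "\<lambda>m. \<exists>p. y = ev x p / x ^ m"] by blast
  have "m = 0 \<or> coeff p 0 \<noteq> 0"
  proof (rule ccontr)
    assume "\<not> ?thesis"
    then obtain n a q where "m = Suc n" "p = pCons 0 q"
      by (metis coeff_pCons_0 not0_implies_Suc pCons_cases)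
    then have "y = ev x q / x ^ n" using p assms(1) by simp
    with min[of n q] \<open>m = Suc n\<close> show False by simp
  qed
  with p show ?thesis using that by blast
qed

lemma laurent_cases:
  assumes "y \<in> laurent"
  obtains p m where "y = to_fract p / ratvar ^ m" "m = 0 \<or> coeff p 0 \<noteq> 0"
  using adjoin_inverse_cases[OF ratvar_nz assms[unfolded laurent_def]] unfolding ev_ratvar by metis

lemma laurentI: "to_fract p / ratvar ^ m \<in> laurent"
  unfolding laurent_def adjoin_inverse[OF ratvar_nz] ev_ratvar by blast

lemma to_fract_laurent [simp]: "to_fract p \<in> laurent"
  using laurentI[of p 0] by simp

lemma laurent_add: "x \<in> laurent \<Longrightarrow> y \<in> laurent \<Longrightarrow> x + y \<in> laurent"
  and laurent_mult: "x \<in> laurent \<Longrightarrow> y \<in> laurent \<Longrightarrow> x * y \<in> laurent"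
  and laurent_diff: "x \<in> laurent \<Longrightarrow> y \<in> laurent \<Longrightarrow> x - y \<in> laurent"
  and laurent_power: "x \<in> laurent \<Longrightarrow> x ^ n \<in> laurent"
  and laurent_ratconst [simp]: "ratconst c \<in> laurent"
  and laurent_0 [simp]: "0 \<in> laurent"
  and laurent_1 [simp]: "1 \<in> laurent"
  and laurent_ratvar [simp]: "ratvar \<in> laurent"
  and laurent_inverse_ratvar [simp]: "inverse ratvar \<in> laurent"
  and laurent_ev: "x \<in> laurent \<Longrightarrow> ev x p \<in> laurent"
  unfolding laurent_def
  by (auto intro: adjoin.intros adjoin_diff adjoin_minus adjoin_power ev_in_adjoin)

lemma laurent_ddt: "x \<in> laurent \<Longrightarrow> ddt x \<in> laurent"
proof -
  assume "x \<in> laurent"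
  moreover have "vf 1 \<in> (witt :: 'a ratop set)" unfolding witt_def by (rule imageI) simp
  ultimately have "vf 1 x \<in> laurent" unfolding witt_eq by blast
  then show ?thesis by (simp add: vf_def)
qed

lemma vf_inject [simp]: "vf f = vf g \<longleftrightarrow> f = g"
proof
  assume "vf f = vf g"
  then have "vf f ratvar = vf g ratvar" by simp
  then show "f = g" by (simp add: vf_def)
qed simp

lemma vf_add: "vf (f + g) = vf f + vf g" and vf_diff: "vf (f - g) = vf f - vf g"
  and vf_scale: "vf (ratconst c * f) = ratop_scale c (vf f)"
  and vf_0: "vf 0 = 0"
  by (auto simp: vf_def ratop_scale_def fun_eq_iff algebra_simps)

section \<open>Intermediate fields of the rational function field\<close>

text \<open>Subfields of the rational function field that contain the base field.\<close>

definition ratsubfield :: "'a::field_char_0 ratfun set \<Rightarrow> bool" where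
  "ratsubfield K \<longleftrightarrow> range ratconst \<subseteq> K \<and> (\<forall>x\<in>K. \<forall>y\<in>K. x + y \<in> K \<and> x * y \<in> K) \<and>
     (\<forall>x\<in>K. inverse x \<in> K)"

context
  fixes K :: "'a::field_char_0 ratfun set"
  assumes K: "ratsubfield K"
begin

lemma ratsubfield_const: "ratconst c \<in> K"
  and ratsubfield_add: "x \<in> K \<Longrightarrow> y \<in> K \<Longrightarrow> x + y \<in> K"
  and ratsubfield_mult: "x \<in> K \<Longrightarrow> y \<in> K \<Longrightarrow> x * y \<in> K"
  and ratsubfield_inverse: "x \<in> K \<Longrightarrow> inverse x \<in> K"
  using K unfolding ratsubfield_def by blast+

lemma ratsubfield_0: "0 \<in> K" and ratsubfield_1: "1 \<in> K"
  using ratsubfield_const[of 0] ratsubfield_const[of 1] by simp_all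

lemma ratsubfield_minus: "x \<in> K \<Longrightarrow> - x \<in> K"
  using ratsubfield_mult[OF ratsubfield_const[of "-1"], of x] by simp

lemma ratsubfield_diff: "x \<in> K \<Longrightarrow> y \<in> K \<Longrightarrow> x - y \<in> K"
  using ratsubfield_add[OF _ ratsubfield_minus, of x y] by simp

lemma ratsubfield_divide: "x \<in> K \<Longrightarrow> y \<in> K \<Longrightarrow> x / y \<in> K"
  using ratsubfield_mult[OF _ ratsubfield_inverse, of x y] by (simp add: divide_inverse)

lemma ratsubfield_power: "x \<in> K \<Longrightarrow> x ^ n \<in> K"
  by (induction n) (auto intro: ratsubfield_mult ratsubfield_1)

lemma ratsubfield_sum: "(\<And>i. i \<in> A \<Longrightarrow> f i \<in> K) \<Longrightarrow> sum f A \<in> K"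
  by (induction A rule: infinite_finite_induct) (auto intro: ratsubfield_add ratsubfield_0)

lemma ratsubfield_ev: "x \<in> K \<Longrightarrow> ev x p \<in> K"
  by (induction p) (auto intro: ratsubfield_add ratsubfield_mult ratsubfield_const ratsubfield_0)

text \<open>Division with remainder does not leave the coefficient field.\<close>

lemma ratsubfield_poly_division:
  assumes "\<And>i. coeff p i \<in> K" "\<And>i. coeff f i \<in> K" "f \<noteq> 0"
  obtains q r where "p = f * q + r" "\<And>i. coeff q i \<in> K" "\<And>i. coeff r i \<in> K"
    "r = 0 \<or> degree r < degree f"
proof -
  have "\<exists>q r. p = f * q + r \<and> (\<forall>i. coeff q i \<in> K) \<and> (\<forall>i. coeff r i \<in> K) \<and>
          (r = 0 \<or> degree r < degree f)"
    using assms(1)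
  proof (induction "if p = 0 then 0 else Suc (degree p)" arbitrary: p rule: less_induct)
    case less
    show ?case
    proof (cases "p = 0 \<or> degree p < degree f")
      case True
      then show ?thesis
        using less.prems by (intro exI[of _ 0] exI[of _ p]) (auto simp: ratsubfield_0)
    next
      case False
      define m where "m = monom (lead_coeff p / lead_coeff f) (degree p - degree f)"
      have m: "coeff m i \<in> K" for i
        using less.prems assms(2) by (auto simp: m_def ratsubfield_0 intro: ratsubfield_divide)
      define p' where "p' = p - f * m"
      have p': "coeff p' i \<in> K" for i
        unfolding p'_def coeff_diff coeff_mult
        by (intro ratsubfield_diff ratsubfield_sum ratsubfield_mult less.prems assms m)
      have "degree m \<le> degree p - degree f" by (simp add: m_def degree_monom_le)
      then have "degree (f * m) \<le> degree p"
        using degree_mult_le[of f m] False by linarith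
      then have "degree p' \<le> degree p" unfolding p'_def by (intro degree_diff_le) auto
      moreover have "coeff p' (degree p) = 0"
      proof -
        have "coeff (f * m) (degree p) = lead_coeff p"
          using False assms(3) by (simp add: m_def mult.commute[of f] coeff_monom_mult)
        then show ?thesis by (simp add: p'_def)
      qed
      ultimately have "p' = 0 \<or> degree p' < degree p" by (rule eq_zero_or_degree_less)
      then have "(if p' = 0 then 0 else Suc (degree p')) < (if p = 0 then 0 else Suc (degree p))"
        using False by auto
      from less.hyps[OF this p'] obtain q r where qr: "p' = f * q + r"
          "\<forall>i. coeff q i \<in> K" "\<forall>i. coeff r i \<in> K" "r = 0 \<or> degree r < degree f"
        by blast
      then have "p = f * (q + m) + r" by (simp add: p'_def algebra_simps)
      moreover have "\<forall>i. coeff (q + m) i \<in> K" using qr(2) m by (simp add: ratsubfield_add)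
      ultimately show ?thesis using qr by blast
    qed
  qed
  then show ?thesis using that by blast
qed

end

text \<open>The subfield generated by one element.  A quotient with denominator zero has the value zero, so that
  no side condition is needed.\<close>

definition ratgen :: "'a::field_char_0 ratfun \<Rightarrow> 'a ratfun set" where
  "ratgen u = {ev u p / ev u q | p q. True}"

lemma ratgen_cases:
  assumes "x \<in> ratgen u"
  obtains p q where "x = ev u p / ev u q" "ev u q \<noteq> 0"
proof -
  obtain p q where x: "x = ev u p / ev u q" using assms by (auto simp: ratgen_def)
  show ?thesis
  proof (cases "ev u q = 0")
    case True
    then have "x = ev u 0 / ev u 1" using x by simp
    then show ?thesis using that[of 0 1] by simp
  qed (use x that in blast)
qed

lemma ratgenI: "ev u p / ev u q \<in> ratgen u"
  by (auto simp: ratgen_def)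

lemma ratsubfield_ratgen: "ratsubfield (ratgen u)"
proof -
  have "ratconst c \<in> ratgen u" for c using ratgenI[of u "[:c:]" 1] by simp
  moreover have "x + y \<in> ratgen u" "x * y \<in> ratgen u" if xy: "x \<in> ratgen u" "y \<in> ratgen u" for x y
  proof -
    obtain p q p' q' where *: "x = ev u p / ev u q" "ev u q \<noteq> 0" "y = ev u p' / ev u q'" "ev u q' \<noteq> 0"
      using xy by (auto elim!: ratgen_cases)
    then have "x + y = ev u (p * q' + p' * q) / ev u (q * q')" "x * y = ev u (p * p') / ev u (q * q')"
      unfolding *(1,3) by (simp_all add: add_frac_eq mult.commute)
    then show "x + y \<in> ratgen u" "x * y \<in> ratgen u" by (metis ratgenI)+
  qed
  moreover have "inverse x \<in> ratgen u" if "x \<in> ratgen u" for x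
    using that by (elim ratgen_cases) (simp add: ratgenI)
  ultimately show ?thesis unfolding ratsubfield_def by blast
qed

lemma ratgen_self: "u \<in> ratgen u"
  using ratgenI[of u "[:0, 1:]" 1] by simp

lemma ratgen_subset:
  assumes "ratsubfield K" "u \<in> K"
  shows "ratgen u \<subseteq> K"
  using assms by (auto simp: ratgen_def intro!: ratsubfield_divide ratsubfield_ev)

text \<open>The variable \<open>t\<close> is algebraic over every subfield that contains a non-constant element.\<close>

lemma ratvar_min_poly:
  assumes K: "ratsubfield K" and a: "a \<in> K" "a \<notin> range ratconst"
  obtains F where "\<And>i. coeff F i \<in> K" "lead_coeff F = 1" "poly F ratvar = 0"
    "\<And>G. (\<And>i. coeff G i \<in> K) \<Longrightarrow> poly G ratvar = 0 \<Longrightarrow> G \<noteq> 0 \<Longrightarrow> degree F \<le> degree G"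
proof -
  define S where "S = {G. (\<forall>i. coeff G i \<in> K) \<and> poly G ratvar = 0 \<and> G \<noteq> 0}"
  obtain P Q where Q: "Q \<noteq> 0" and PQ: "a = Fract P Q" by (cases a) auto
  have aQ: "a * to_fract Q = to_fract P" using Q by (simp add: PQ to_fract_def eq_fract)
  define G where "G = smult a (map_poly ratconst Q) - map_poly ratconst P"
  have cG: "coeff G i = a * ratconst (coeff Q i) - ratconst (coeff P i)" for i
    by (simp add: G_def coeff_map_poly)
  have "coeff G i \<in> K" for i
    unfolding cG using K a by (intro ratsubfield_diff ratsubfield_mult ratsubfield_const)
  moreover have "poly G ratvar = 0"
    using aQ by (simp add: G_def ev_ratvar flip: ev_def)
  moreover have "G \<noteq> 0"
  proof
    assume "G = 0"
    with cG[of "degree Q"] have "a = ratconst (coeff P (degree Q) / lead_coeff Q)"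
      using Q by (simp add: field_simps)
    with a(2) show False by blast
  qed
  ultimately have "G \<in> S" by (simp add: S_def)
  then obtain F where F: "F \<in> S" and min: "\<And>H. H \<in> S \<Longrightarrow> degree F \<le> degree H"
    using ex_has_least_nat[of "\<lambda>H. H \<in> S" G degree] by blast
  define F' where "F' = smult (inverse (lead_coeff F)) F"
  have "coeff F' i \<in> K" for i
    using F K unfolding F'_def S_def by (auto intro!: ratsubfield_mult ratsubfield_inverse)
  moreover have "lead_coeff F' = 1" "poly F' ratvar = 0" "degree F' = degree F"
    using F by (auto simp: F'_def S_def)
  ultimately show ?thesis using that[of F'] min unfolding S_def by auto
qed

lemma min_poly_dvd:
  assumes K: "ratsubfield K" and F: "\<And>i. coeff F i \<in> K" "F \<noteq> 0" "poly F x = 0"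
    and min: "\<And>G. (\<And>i. coeff G i \<in> K) \<Longrightarrow> poly G x = 0 \<Longrightarrow> G \<noteq> 0 \<Longrightarrow> degree F \<le> degree G"
    and G: "\<And>i. coeff G i \<in> K" "poly G x = 0"
  shows "F dvd G"
proof -
  obtain q r where qr: "G = F * q + r" "\<And>i. coeff q i \<in> K" "\<And>i. coeff r i \<in> K"
      "r = 0 \<or> degree r < degree F"
    by (rule ratsubfield_poly_division[OF K G(1) F(1,2)]) blast
  have "poly r x = 0" using G(2) F(3) qr(1) by simp
  then have "r = 0" using min[of r] qr(3,4) by (meson not_le)
  then show ?thesis using qr(1) by simp
qed

subsection \<open>Polynomials in two variables\<close>

text \<open>The elements of type \<open>'a poly poly\<close> are read as polynomials in \<open>X\<close> whose coefficients are
  polynomials in \<open>t\<close>.  The next function substitutes \<open>c\<close> for \<open>t\<close>.\<close>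

definition at_inner :: "'a::comm_ring_1 \<Rightarrow> 'a poly poly \<Rightarrow> 'a poly" where
  "at_inner c = map_poly (\<lambda>p. poly p c)"

text \<open>The polynomial \<open>p(X)\<close>, which does not contain \<open>t\<close>.\<close>

definition outer :: "'a::comm_ring_1 poly \<Rightarrow> 'a poly poly" where
  "outer = map_poly (\<lambda>c. [:c:])"

lemma coeff_at_inner [simp]: "coeff (at_inner c p) i = poly (coeff p i) c"
  by (simp add: at_inner_def coeff_map_poly)

lemma coeff_outer [simp]: "coeff (outer p) i = [:coeff p i:]"
  by (simp add: outer_def coeff_map_poly)

lemma at_inner_0 [simp]: "at_inner c 0 = 0"
  by (rule poly_eqI) simp

lemma at_inner_mult [simp]: "at_inner c (p * q) = at_inner c p * at_inner c q"
  unfolding at_inner_def by (rule map_poly_hom_mult) auto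

lemma at_inner_smult [simp]: "at_inner c (smult d p) = smult (poly d c) (at_inner c p)"
  by (rule poly_eqI) simp

lemma at_inner_outer [simp]: "at_inner c (outer p) = p"
  by (rule poly_eqI) simp

lemma at_inner_diff [simp]: "at_inner c (p - q) = at_inner c p - at_inner c q"
  by (rule poly_eqI) simp

lemma fract_poly_outer: "map_poly to_fract (outer p) = map_poly ratconst p"
  by (rule poly_eqI) (simp add: coeff_map_poly ratconst_def)

lemma at_inner_eq_0_imp_dvd:
  fixes p :: "'a::field poly poly"
  assumes "at_inner c p = 0"
  obtains q where "p = smult [:-c, 1:] q"
proof -
  have "[:-c, 1:] dvd coeff p i" for i
    using assms coeff_at_inner[of c p i] by (simp add: poly_eq_0_iff_dvd)
  then have "[:[:-c, 1:]:] dvd p" by (simp add: const_poly_dvd_iff)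
  then show ?thesis using that by (auto elim!: dvdE)
qed

lemma clear_denominators:
  fixes G :: "'a::field_char_0 ratfun poly"
  shows "\<exists>d H. d \<noteq> 0 \<and> map_poly to_fract H = smult (to_fract d) G"
proof (induction G)
  case 0
  show ?case by (intro exI[of _ 1] exI[of _ 0]) simp
next
  case (pCons a G)
  then obtain d H where dH: "d \<noteq> 0" "map_poly to_fract H = smult (to_fract d) G" by blast
  obtain P Q where "Q \<noteq> 0" "a = Fract P Q" by (cases a)
  then have aQ: "a * to_fract Q = to_fract P" by (simp add: to_fract_def eq_fract)
  have "map_poly to_fract (pCons (P * d) (smult Q H)) = smult (to_fract (d * Q)) (pCons a G)"
    by (simp add: map_poly_pCons dH(2) mult.commute flip: aQ)
  moreover have "d * Q \<noteq> 0" using dH(1) \<open>Q \<noteq> 0\<close> by simp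
  ultimately show ?case by blast
qed

text \<open>Clearing denominators in such a way that no linear polynomial in \<open>t\<close> divides the result.\<close>

lemma primitive_multiple:
  fixes G :: "'a::field_char_0 ratfun poly"
  assumes "G \<noteq> 0"
  obtains c H where "c \<noteq> 0" "map_poly to_fract H = smult c G" "\<And>x. at_inner x H \<noteq> 0"
proof -
  define S where "S = {H. \<exists>c. c \<noteq> 0 \<and> map_poly to_fract H = smult c G}"
  obtain d H0 where "d \<noteq> 0" "map_poly to_fract H0 = smult (to_fract d) G"
    using clear_denominators by blast
  then have "H0 \<in> S" unfolding S_def by (auto intro!: exI[of _ "to_fract d"])
  then obtain H where H: "H \<in> S" and min: "\<And>H'. H' \<in> S \<Longrightarrow> degree (lead_coeff H) \<le> degree (lead_coeff H')"
    using ex_has_least_nat[of "\<lambda>H. H \<in> S" H0 "\<lambda>H. degree (lead_coeff H)"] by blast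
  obtain c where c: "c \<noteq> 0" "map_poly to_fract H = smult c G" using H by (auto simp: S_def)
  have "H \<noteq> 0" using c assms by auto
  have "at_inner x H \<noteq> 0" for x
  proof
    assume "at_inner x H = 0"
    then obtain H' where H': "H = smult [:-x, 1:] H'" by (rule at_inner_eq_0_imp_dvd)
    have "map_poly to_fract H' = smult (c / to_fract [:-x, 1:]) G"
    proof -
      have "smult (to_fract [:-x, 1:]) (map_poly to_fract H') = smult c G"
        using c(2) by (simp add: H')
      then have "smult (inverse (to_fract [:-x, 1:])) (smult (to_fract [:-x, 1:]) (map_poly to_fract H'))
          = smult (inverse (to_fract [:-x, 1:])) (smult c G)" by simp
      then show ?thesis by (simp add: divide_inverse mult.commute)
    qed
    then have "H' \<in> S" using c(1) unfolding S_def
      by (auto intro!: exI[of _ "c / to_fract [:-x, 1:]"])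
    moreover have "lead_coeff H' \<noteq> 0" using H' \<open>H \<noteq> 0\<close> by auto
    then have "degree (lead_coeff H') < degree (lead_coeff H)"
      unfolding H' lead_coeff_smult by (subst degree_mult_eq) auto
    ultimately show False using min[of H'] by simp
  qed
  then show ?thesis using that c by blast
qed

text \<open>Gauss's lemma: a primitive polynomial that divides \<open>q\<close> over the field of rational functions in \<open>t\<close>
  divides it over the polynomials in \<open>t\<close>.\<close>

lemma primitive_dvd:
  fixes p q :: "'a::{alg_closed_field,field_char_0} poly poly"
  assumes prim: "\<And>x. at_inner x p \<noteq> 0" and dvd: "map_poly to_fract p dvd map_poly to_fract q"
  shows "p dvd q"
proof -
  obtain r where r: "map_poly to_fract q = map_poly to_fract p * r" using dvd by (elim dvdE)
  obtain d H where dH: "d \<noteq> 0" "map_poly to_fract H = smult (to_fract d) r"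
    using clear_denominators[of r] by blast
  have "map_poly to_fract (smult d q) = map_poly to_fract (p * H)"
    by (simp add: r dH del: fract_poly_eq_iff)
  then have "smult d q = p * H" by (simp only: fract_poly_eq_iff)
  with dH(1) have ex: "d \<noteq> 0 \<and> (\<exists>H. smult d q = p * H)" by blast
  obtain d H where d: "d \<noteq> 0" "smult d q = p * H"
      and min: "\<And>d' H'. d' \<noteq> 0 \<Longrightarrow> smult d' q = p * H' \<Longrightarrow> degree d \<le> degree d'"
    using ex_has_least_nat[of "\<lambda>d. d \<noteq> 0 \<and> (\<exists>H. smult d q = p * H)" d degree, OF ex] by blast
  have "degree d = 0"
  proof (rule ccontr)
    assume "degree d \<noteq> 0"
    then obtain x where x: "poly d x = 0" using alg_closed_imp_poly_has_root by blast
    then have "at_inner x p * at_inner x H = 0"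
      using arg_cong[OF d(2), of "at_inner x"] by simp
    then have "at_inner x H = 0" using prim by simp
    then obtain H' where H': "H = smult [:-x, 1:] H'" by (rule at_inner_eq_0_imp_dvd)
    obtain d' where d': "d = [:-x, 1:] * d'" using x by (auto simp: poly_eq_0_iff_dvd elim!: dvdE)
    have "smult [:-x, 1:] (smult d' q) = smult [:-x, 1:] (p * H')"
      using d(2) unfolding H' d' by (simp only: mult_smult_right smult_smult)
    then have "smult [:-x, 1:] (smult d' q - p * H') = 0" by (simp add: smult_diff_right)
    then have "smult d' q = p * H'" by simp
    moreover have "d' \<noteq> 0" using d(1) d' by auto
    moreover from this have "degree d' < degree d" unfolding d' by (subst degree_mult_eq) auto
    ultimately show False using min[of d' H'] by simp
  qed
  then obtain c where c: "d = [:c:]" by (rule degree_eq_zeroE)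
  with d(1) have "c \<noteq> 0" by simp
  have "p * smult [:inverse c:] H = smult [:inverse c:] (smult d q)" by (simp add: d(2))
  also have "\<dots> = q" using \<open>c \<noteq> 0\<close> by (simp add: c flip: one_pCons)
  finally show ?thesis by (metis dvdI)
qed

lemma coeff_mult_bounded:
  fixes c d :: "'a::idom poly"
  assumes "degree c \<le> D" "degree d \<le> E"
  shows "coeff (c * d) (D + E) = coeff c D * coeff d E"
proof (cases "degree c = D \<and> degree d = E")
  case True then show ?thesis by (metis coeff_mult_degree_sum)
next
  case False
  then have "coeff c D * coeff d E = 0" using assms by (auto simp: coeff_eq_0)
  moreover have "degree (c * d) < D + E" using degree_mult_le[of c d] False assms by linarith
  ultimately show ?thesis by (simp add: coeff_eq_0)
qed

text \<open>The degree in \<open>t\<close> is additive; so if the degree of \<open>p q\<close> does not exceed that of \<open>p\<close>, then \<open>q\<close> does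
  not contain \<open>t\<close>.\<close>

lemma inner_degree_mult:
  fixes p q :: "'a::idom poly poly"
  assumes "p \<noteq> 0" "q \<noteq> 0" and B: "\<And>i. degree (coeff (p * q) i) \<le> M" and i: "M \<le> degree (coeff p i)"
  shows "degree (coeff q j) = 0"
proof -
  define D where "D = Max ((degree \<circ> coeff p) ` {..degree p})"
  define E where "E = Max ((degree \<circ> coeff q) ` {..degree q})"
  have D: "degree (coeff p i) \<le> D" for i
  proof (cases "i \<le> degree p")
    case True then show ?thesis unfolding D_def by (intro Max_ge) auto
  qed (simp add: coeff_eq_0)
  have E: "degree (coeff q i) \<le> E" for i
  proof (cases "i \<le> degree q")
    case True then show ?thesis unfolding E_def by (intro Max_ge) auto
  qed (simp add: coeff_eq_0)
  have nz: "map_poly (\<lambda>c. coeff c (Max ((degree \<circ> coeff r) ` {..degree r}))) r \<noteq> 0"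
    if "r \<noteq> 0" for r :: "'a poly poly"
  proof -
    define N where "N = Max ((degree \<circ> coeff r) ` {..degree r})"
    have "N \<in> (degree \<circ> coeff r) ` {..degree r}" unfolding N_def by (intro Max_in) auto
    then obtain i where i: "degree (coeff r i) = N" by auto
    show ?thesis
    proof (cases "N = 0")
      case True
      have "degree (lead_coeff r) \<le> N" unfolding N_def by (intro Max_ge) auto
      with True have "degree (lead_coeff r) = 0" by simp
      moreover have "lead_coeff r \<noteq> 0" using that by simp
      ultimately have "coeff (lead_coeff r) N \<noteq> 0" using True by (metis leading_coeff_0_iff)
      then show ?thesis unfolding N_def[symmetric]
        by (metis (mono_tags, lifting) coeff_0 coeff_map_poly)
    next
      case False
      then have "coeff (coeff r i) N \<noteq> 0" using i by (metis degree_0 leading_coeff_0_iff)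
      then show ?thesis unfolding N_def[symmetric]
        by (metis (mono_tags, lifting) coeff_0 coeff_map_poly)
    qed
  qed
  define tp where "tp = map_poly (\<lambda>c. coeff c D) p"
  define tq where "tq = map_poly (\<lambda>c. coeff c E) q"
  have "tp * tq \<noteq> 0" using nz assms(1,2) unfolding tp_def tq_def D_def E_def by simp
  then obtain n where n: "coeff (tp * tq) n \<noteq> 0" by (metis leading_coeff_0_iff)
  have "coeff (tp * tq) n = coeff (coeff (p * q) n) (D + E)"
    unfolding coeff_mult[of p q] coeff_mult[of tp tq] coeff_sum
    by (intro sum.cong refl) (simp add: coeff_mult_bounded D E tp_def tq_def coeff_map_poly)
  with n have "D + E \<le> degree (coeff (p * q) n)" by (metis le_degree)
  then have "D + E \<le> D" using B[of n] i D[of i] by linarith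
  then show ?thesis using E[of j] by simp
qed


subsection \<open>Lueroth's theorem\<close>

lemma ratconst_if_proportional:
  assumes "to_fract e = u * to_fract d" "d \<noteq> 0" "smult a d = smult b e" "b \<noteq> 0"
  shows "u \<in> range ratconst"
proof -
  have "to_fract (smult a d) = to_fract (smult b e)" using assms(3) by simp
  then have "ratconst a * to_fract d = ratconst b * to_fract e"
    unfolding ev_ratvar[symmetric] by simp
  then have "(ratconst a - ratconst b * u) * to_fract d = 0"
    using assms(1) by (simp add: algebra_simps)
  then have "u = ratconst (a / b)" using assms(2,4) by (simp add: field_simps)
  then show ?thesis by blast
qed

text \<open>The heart of Lueroth's theorem.  If \<open>u = e(t) / d(t)\<close> is a non-constant coefficient of the
  minimal polynomial of \<open>t\<close> over \<open>K\<close>, then a comparison of degrees in \<open>t\<close> shows that this minimal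
  polynomial is \<open>e(X) - u d(X)\<close> up to a constant factor.\<close>

lemma lueroth_form:
  fixes K :: "'a::{alg_closed_field,field_char_0} ratfun set"
  assumes K: "ratsubfield K" and a: "a \<in> K" "a \<notin> range ratconst"
  obtains u e d where "u \<in> K" "u \<notin> range ratconst" "d \<noteq> 0" "to_fract e = u * to_fract d"
    "K \<subseteq> ratgen u"
    "\<And>b P Q. b \<in> K \<Longrightarrow> to_fract P = b * to_fract Q \<Longrightarrow>
       smult d (outer e) - smult e (outer d) dvd smult Q (outer P) - smult P (outer Q)"
proof -
  obtain F where F: "\<And>i. coeff F i \<in> K" "lead_coeff F = 1" "poly F ratvar = 0"
    and min: "\<And>G. (\<And>i. coeff G i \<in> K) \<Longrightarrow> poly G ratvar = 0 \<Longrightarrow> G \<noteq> 0 \<Longrightarrow> degree F \<le> degree G"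
    by (rule ratvar_min_poly[OF K a]) blast
  have F0: "F \<noteq> 0" using F(2) by auto
  have dvdF: "F dvd G" if "\<And>i. coeff G i \<in> K" "poly G ratvar = 0" for G
    by (rule min_poly_dvd[OF K F(1) F0 F(3)]) (use min that in blast)+
  have "\<exists>i. coeff F i \<notin> range ratconst"
  proof (rule ccontr)
    assume "\<not> ?thesis"
    then have "\<forall>i. \<exists>c. coeff F i = ratconst c" by blast
    then obtain f where f: "\<And>i. coeff F i = ratconst (f i)" by metis
    define p where "p = Abs_poly (\<lambda>i. if i \<le> degree F then f i else 0)"
    have "coeff p i = (if i \<le> degree F then f i else 0)" for i
      unfolding p_def by (subst coeff_Abs_poly[of "degree F"]) auto
    then have "F = map_poly ratconst p"
      by (intro poly_eqI) (auto simp: coeff_map_poly f[symmetric] coeff_eq_0)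
    then have "ev ratvar p = 0" "p \<noteq> 0" using F(3) F0 by (auto simp: ev_def)
    then show False using ev_eq_0_iff[OF ratvar_nonconst] by blast
  qed
  then obtain i where i: "coeff F i \<notin> range ratconst" by blast
  define u where "u = coeff F i"
  have u: "u \<in> K" "u \<notin> range ratconst" using F(1) i by (simp_all add: u_def)
  obtain c H where c: "c \<noteq> 0" and H: "map_poly to_fract H = smult c F" and prim: "\<And>x. at_inner x H \<noteq> 0"
    by (rule primitive_multiple[OF F0]) blast
  have Hc: "to_fract (coeff H j) = c * coeff F j" for j
    using arg_cong[OF H, of "\<lambda>p. coeff p j"] by (simp add: coeff_map_poly)
  \<comment> \<open>\<open>F\<close> is monic, so \<open>u\<close> is the quotient of two coefficients of the primitive multiple \<open>H\<close> of \<open>F\<close>.\<close>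
  define d where "d = coeff H (degree F)"
  define e where "e = coeff H i"
  have d: "to_fract d = c" and ed: "to_fract e = u * to_fract d"
    using Hc F(2) by (simp_all add: d_def e_def u_def)
  have d0: "d \<noteq> 0" using d c by auto
  have H0: "H \<noteq> 0" using prim by auto
  define B where "B = smult d (outer e) - smult e (outer d)"
  have dvdH: "H dvd smult Q (outer P) - smult P (outer Q)" if "b \<in> K" "to_fract P = b * to_fract Q" for b P Q
  proof (rule primitive_dvd[OF prim])
    define G where "G = map_poly ratconst P - smult b (map_poly ratconst Q)"
    have "coeff G j \<in> K" for j
      unfolding G_def using K that(1)
      by (simp add: coeff_map_poly) (intro ratsubfield_diff ratsubfield_mult ratsubfield_const)
    moreover have "poly G ratvar = 0"
      using that(2) by (simp add: G_def ev_ratvar flip: ev_def)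
    ultimately have "F dvd G" by (rule dvdF)
    moreover have "map_poly to_fract (smult Q (outer P) - smult P (outer Q)) = smult (to_fract Q) G"
      using that(2) by (simp add: fract_poly_outer G_def smult_diff_right mult.commute)
    ultimately show "map_poly to_fract H dvd map_poly to_fract (smult Q (outer P) - smult P (outer Q))"
      unfolding H using c by (simp add: dvd_smult smult_dvd)
  qed
  have B0: "B \<noteq> 0"
  proof
    assume "B = 0"
    then have "coeff B (degree d) = 0" by simp
    then have "smult (coeff e (degree d)) d = smult (lead_coeff d) e"
      by (simp add: B_def)
    then show False using ratconst_if_proportional[OF ed d0] d0 u(2) by (metis leading_coeff_0_iff)
  qed
  obtain q where q: "B = H * q" using dvdH[OF u(1) ed] unfolding B_def by (elim dvdE)
  have q0: "q \<noteq> 0" using B0 q by auto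
  \<comment> \<open>The degree of \<open>B\<close> in \<open>t\<close> is at most that of \<open>H\<close>, so the cofactor \<open>q\<close> does not contain \<open>t\<close>.\<close>
  have degB: "degree (coeff B j) \<le> max (degree d) (degree e)" for j
    unfolding B_def coeff_diff coeff_smult coeff_outer
    by (intro degree_diff_le) (auto intro: order_trans[OF degree_smult_le] simp: mult.commute)
  have "\<exists>j. max (degree d) (degree e) \<le> degree (coeff H j)"
    unfolding d_def e_def by (metis max_def order_refl)
  then obtain j where "max (degree d) (degree e) \<le> degree (coeff H j)" by blast
  then have degq: "degree (coeff q k) = 0" for k
    using inner_degree_mult[OF H0 q0 degB[unfolded q]] by blast
  then have at_q: "at_inner x q = at_inner y q" for x y
    by (intro poly_eqI) (metis coeff_at_inner degree_eq_zeroE poly_const_conv)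
  have at_q0: "at_inner x q \<noteq> 0" for x
  proof
    assume "at_inner x q = 0"
    then have "poly (coeff q k) x = 0" for k by (metis coeff_0 coeff_at_inner)
    then have "coeff q k = 0" for k using degq[of k] by (metis degree_eq_zeroE pCons_0_0 poly_const_conv)
    then show False using q0 by (metis leading_coeff_0_iff)
  qed
  \<comment> \<open>A root \<open>x\<close> of \<open>q\<close> would be a common root of \<open>d\<close> and \<open>e\<close>, because \<open>u\<close> is not constant; then \<open>t - x\<close>
    would divide \<open>B\<close>, although it divides neither \<open>H\<close> nor \<open>q\<close>.\<close>
  have "degree (at_inner 0 q) = 0"
  proof (rule ccontr)
    assume "degree (at_inner 0 q) \<noteq> 0"
    then obtain x where "poly (at_inner 0 q) x = 0" using alg_closed_imp_poly_has_root by blast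
    then have x: "poly (at_inner y q) x = 0" for y using at_q by metis
    have evl: "poly d y * poly e x = poly e y * poly d x" for y
      using arg_cong[OF q, of "\<lambda>p. poly (at_inner y p) x"] x[of y] by (simp add: B_def)
    then have "poly (smult (poly e x) d) y = poly (smult (poly d x) e) y" for y
      by (simp add: mult.commute)
    then have prp: "smult (poly e x) d = smult (poly d x) e"
      unfolding poly_eq_poly_eq_iff[symmetric] by blast
    have "poly d x = 0" using ratconst_if_proportional[OF ed d0 prp] u(2) by blast
    then have "poly e x = 0" using prp d0 by simp
    then have "at_inner x B = 0" using \<open>poly d x = 0\<close> by (simp add: B_def)
    then have "at_inner x H * at_inner x q = 0" by (simp add: q)
    then show False using prim at_q0 by simp
  qed
  then obtain r where r: "at_inner 0 q = [:r:]" by (rule degree_eq_zeroE)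
  have "coeff q k = coeff [:[:r:]:] k" for k
  proof -
    obtain s where s: "coeff q k = [:s:]" using degq by (rule degree_eq_zeroE)
    then have "coeff [:r:] k = s" unfolding r[symmetric] by simp
    with s show ?thesis by (cases k) auto
  qed
  then have qr: "q = [:[:r:]:]" by (rule poly_eqI)
  then have r0: "r \<noteq> 0" using q0 by auto
  have BH: "B = smult [:r:] H" using q qr by (simp add: mult.commute)
  have BdvdH: "B dvd G" if HG: "H dvd G" for G
  proof -
    obtain k where "G = H * k" using HG by (elim dvdE)
    then have "G = B * smult [:inverse r:] k" using r0 by (simp add: BH flip: one_pCons)
    then show ?thesis by (rule dvdI)
  qed
  define F1 where "F1 = map_poly ratconst e - smult u (map_poly ratconst d)"
  have F1: "smult (to_fract d) F1 = smult (c * ratconst r) F"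
  proof -
    have "smult (to_fract d) F1 = map_poly to_fract B"
      using ed by (simp add: F1_def B_def fract_poly_outer smult_diff_right mult.commute)
    also have "\<dots> = smult (ratconst r) (map_poly to_fract H)" by (simp add: BH ratconst_def)
    finally show ?thesis by (simp add: H mult.commute)
  qed
  have F1_0: "F1 \<noteq> 0" using F1 c r0 F0 by auto
  have "degree (smult (to_fract d) F1) = degree (smult (c * ratconst r) F)" by (simp add: F1)
  then have degF1: "degree F1 = degree F" using d0 c r0 by simp
  have F1_root: "poly F1 ratvar = 0"
    using ed by (simp add: F1_def ev_ratvar flip: ev_def)
  have L: "ratsubfield (ratgen u)" by (rule ratsubfield_ratgen)
  have F1_coeff: "coeff F1 k \<in> ratgen u" for k
    unfolding F1_def using ratsubfield_const[OF L] ratgen_self[of u]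
    by (simp add: coeff_map_poly) (intro ratsubfield_diff[OF L] ratsubfield_mult[OF L])
  have const_coeff: "coeff (map_poly ratconst P) k \<in> ratgen u" for P k
    using ratsubfield_const[OF L] by (simp add: coeff_map_poly)
  have LK: "ratgen u \<subseteq> K" by (rule ratgen_subset[OF K u(1)])
  \<comment> \<open>Reduce numerator and denominator of \<open>b\<close> modulo \<open>F1\<close>: the remainders \<open>r1\<close>, \<open>r2\<close> have coefficients in
    \<open>ratgen u\<close>, and \<open>b r1 - r2\<close> vanishes at \<open>t\<close> but has degree less than the minimal polynomial.\<close>
  have "b \<in> ratgen u" if b: "b \<in> K" for b
  proof -
    obtain P Q where Q: "Q \<noteq> 0" and PQ: "b = Fract P Q" by (cases b) auto
    have bQ: "to_fract P = b * to_fract Q" using Q by (simp add: PQ to_fract_def eq_fract)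
    obtain q1 r1 where 1: "map_poly ratconst Q = F1 * q1 + r1" "\<And>i. coeff r1 i \<in> ratgen u"
        "r1 = 0 \<or> degree r1 < degree F1"
      by (rule ratsubfield_poly_division[OF L const_coeff F1_coeff F1_0]) blast
    obtain q2 r2 where 2: "map_poly ratconst P = F1 * q2 + r2" "\<And>i. coeff r2 i \<in> ratgen u"
        "r2 = 0 \<or> degree r2 < degree F1"
      by (rule ratsubfield_poly_division[OF L const_coeff F1_coeff F1_0]) blast
    have root: "poly r1 ratvar = to_fract Q" "poly r2 ratvar = to_fract P"
      using arg_cong[OF 1(1), of "\<lambda>p. poly p ratvar"] arg_cong[OF 2(1), of "\<lambda>p. poly p ratvar"]
        F1_root by (simp_all add: ev_ratvar flip: ev_def)
    have r1: "r1 \<noteq> 0" using root(1) Q by auto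
    define G where "G = smult b r1 - r2"
    have "coeff G k \<in> K" for k
      unfolding G_def using 1(2) 2(2) LK b K
      by (simp add: subset_iff) (intro ratsubfield_diff ratsubfield_mult, auto)
    moreover have "poly G ratvar = 0" using root bQ by (simp add: G_def)
    moreover have "G = 0 \<or> degree G < degree F"
    proof (cases "r2 = 0")
      case True
      then show ?thesis using 1(3) r1 degF1 by (simp add: G_def)
    next
      case False
      then show ?thesis using 1(3) 2(3) r1 degF1 unfolding G_def
        by (intro disjI2 degree_diff_less) (auto intro: le_less_trans[OF degree_smult_le])
    qed
    ultimately have "G = 0" using min[of G] by force
    then have "b * lead_coeff r1 = coeff r2 (degree r1)"
      unfolding G_def by (metis coeff_smult eq_iff_diff_eq_0)
    then have "b = coeff r2 (degree r1) / lead_coeff r1" using r1 by (simp add: field_simps)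
    then show ?thesis using ratsubfield_divide[OF L 2(2) 1(2)] by metis
  qed
  then have "K \<subseteq> ratgen u" by blast
  then show ?thesis
  proof (rule that[OF u d0 ed])
    fix b P Q assume "b \<in> K" "to_fract P = b * to_fract Q"
    then show "smult d (outer e) - smult e (outer d) dvd smult Q (outer P) - smult P (outer Q)"
      using BdvdH[OF dvdH] unfolding B_def by blast
  qed
qed


subsection \<open>Laurent polynomials in an intermediate field\<close>

lemma monom_if_no_nonzero_root:
  fixes p :: "'a::alg_closed_field poly"
  assumes "p \<noteq> 0" "\<And>x. x \<noteq> 0 \<Longrightarrow> poly p x \<noteq> 0"
  obtains c i where "c \<noteq> 0" "p = monom c i"
proof -
  obtain q where q: "p = [:-0, 1:] ^ order 0 p * q" "\<not> [:-0, 1:] dvd q"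
    using order_decomp[OF assms(1), of 0] by blast
  have "poly q x \<noteq> 0" for x
  proof (cases "x = 0")
    case True
    then show ?thesis using q(2) by (simp add: poly_eq_0_iff_dvd)
  next
    case False
    have "poly p x = x ^ order 0 p * poly q x" by (subst q(1)) simp
    then show ?thesis using assms(2)[OF False] by auto
  qed
  then have "degree q = 0" using alg_closed_imp_poly_has_root by blast
  then obtain c where c: "q = [:c:]" by (rule degree_eq_zeroE)
  have "p = monom c (order 0 p)"
    by (subst q(1)) (simp add: c monom_altdef mult.commute)
  moreover have "c \<noteq> 0" using q(2) c by auto
  ultimately show ?thesis using that by blast
qed

lemma ratvar_power: "ratvar ^ m = to_fract (monom 1 m)"
  by (simp flip: ev_ratvar)

lemma laurent_if_monom_denominator:
  assumes "to_fract p = x * to_fract (monom c i)" "c \<noteq> 0"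
  shows "x \<in> laurent"
proof -
  have "to_fract (monom c i) = ratconst c * ratvar ^ i"
    by (simp flip: ev_ratvar)
  then have "x = to_fract (smult (inverse c) p) / ratvar ^ i"
    using assms ratvar_nz unfolding ev_ratvar[symmetric] by (simp add: field_simps)
  then show ?thesis using laurentI by metis
qed

text \<open>Lueroth's theorem for an intermediate field that contains a non-constant Laurent polynomial:
  the generator can be chosen to be a Laurent polynomial too.\<close>

lemma lueroth_laurent:
  fixes K :: "'a::{alg_closed_field,field_char_0} ratfun set"
  assumes K: "ratsubfield K" and a: "a \<in> K" "a \<in> laurent" "a \<notin> range ratconst"
  obtains u where "u \<in> K" "u \<in> laurent" "u \<notin> range ratconst" "K \<subseteq> ratgen u"
proof -
  obtain u e d where u: "u \<in> K" "u \<notin> range ratconst" and d: "d \<noteq> 0" and ed: "to_fract e = u * to_fract d"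
    and gen: "K \<subseteq> ratgen u"
    and dvd: "\<And>b P Q. b \<in> K \<Longrightarrow> to_fract P = b * to_fract Q \<Longrightarrow>
       smult d (outer e) - smult e (outer d) dvd smult Q (outer P) - smult P (outer Q)"
    by (rule lueroth_form[OF K a(1,3)]) blast
  obtain P m where P: "a = to_fract P / ratvar ^ m" "m = 0 \<or> coeff P 0 \<noteq> 0"
    using a(2) by (rule laurent_cases)
  define G where "G = smult (monom 1 m) (outer P) - smult P (outer (monom 1 m))"
  define B where "B = smult d (outer e) - smult e (outer d)"
  have "to_fract P = a * to_fract (monom 1 m)"
    using P(1) ratvar_nz by (simp flip: ratvar_power)
  from dvd[OF a(1) this] obtain H where H: "G = B * H" unfolding G_def B_def by (elim dvdE)
  \<comment> \<open>The constant term of \<open>G\<close> (or, if \<open>a\<close> is a polynomial, its leading coefficient) is a monomial in \<open>t\<close>;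
    it is a multiple of the corresponding coefficient of \<open>B\<close>, a combination of \<open>d\<close> and \<open>e\<close>.\<close>
  have "\<exists>\<alpha> \<beta> k c. c \<noteq> 0 \<and> (smult \<alpha> d - smult \<beta> e) * k = monom c m"
  proof (cases "m = 0")
    case False
    have "coeff G 0 = coeff B 0 * coeff H 0" by (simp add: H coeff_mult)
    moreover have "coeff G 0 = monom (coeff P 0) m"
      using False by (simp add: G_def smult_monom mult.commute)
    moreover have "coeff B 0 = smult (coeff e 0) d - smult (coeff d 0) e"
      by (simp add: B_def mult.commute)
    ultimately show ?thesis using P(2) False by metis
  next
    case True
    have "degree P \<noteq> 0"
    proof
      assume "degree P = 0"
      then obtain c where "P = [:c:]" by (rule degree_eq_zeroE)
      then have "a = ratconst c" using P(1) True by (simp add: ratconst_def)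
      with a(3) show False by blast
    qed
    have cG: "coeff G i = [:coeff P i:]" if "i > 0" for i
      using that True by (simp add: G_def coeff_monom)
    have "degree G = degree P"
    proof (rule antisym)
      show "degree G \<le> degree P"
        using \<open>degree P \<noteq> 0\<close> by (intro degree_le) (auto simp: cG coeff_eq_0)
      show "degree P \<le> degree G"
        using \<open>degree P \<noteq> 0\<close> by (intro le_degree) (auto simp: cG)
    qed
    then have "lead_coeff B * lead_coeff H = [:lead_coeff P:]"
      using \<open>degree P \<noteq> 0\<close> cG[of "degree P"] lead_coeff_mult[of B H] by (simp add: H)
    moreover have "lead_coeff B = smult (coeff e (degree B)) d - smult (coeff d (degree B)) e"
      by (simp add: B_def mult.commute)
    moreover have "[:lead_coeff P:] = monom (lead_coeff P) m" using True by (simp add: monom_0)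
    moreover have "lead_coeff P \<noteq> 0" using \<open>degree P \<noteq> 0\<close> by auto
    ultimately show ?thesis by metis
  qed
  then obtain \<alpha> \<beta> k c where c: "c \<noteq> 0" and k: "(smult \<alpha> d - smult \<beta> e) * k = monom c m" by blast
  define w where "w = smult \<alpha> d - smult \<beta> e"
  have "w \<noteq> 0" using k c by (auto simp: w_def)
  moreover have "poly w x \<noteq> 0" if "x \<noteq> 0" for x
    using arg_cong[OF k, of "\<lambda>p. poly p x"] that c unfolding w_def[symmetric]
    by (auto simp: poly_monom)
  ultimately obtain c' i where w: "c' \<noteq> 0" "w = monom c' i"
    by (rule monom_if_no_nonzero_root)
  have wd: "to_fract w = (ratconst \<alpha> - ratconst \<beta> * u) * to_fract d"
    using ed by (simp add: w_def algebra_simps flip: ev_ratvar)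
  show ?thesis
  proof (cases "\<beta> = 0")
    case True
    then have "to_fract (smult \<alpha> e) = u * to_fract (monom c' i)"
      using wd w(2) ed by (simp flip: ev_ratvar)
    then have "u \<in> laurent" using w(1) by (rule laurent_if_monom_denominator)
    then show ?thesis using that u gen by blast
  next
    case False
    \<comment> \<open>The generator with the monomial \<open>w = \<alpha> d - \<beta> e\<close> as its denominator.\<close>
    define v where "v = inverse (ratconst \<alpha> - ratconst \<beta> * u)"
    have nz: "ratconst \<alpha> - ratconst \<beta> * u \<noteq> 0" using wd \<open>w \<noteq> 0\<close> by auto
    have "to_fract d = v * to_fract (monom c' i)"
      using wd nz by (simp add: v_def w(2) field_simps)
    then have "v \<in> laurent" using w(1) by (rule laurent_if_monom_denominator)
    moreover have "v \<in> K"
      unfolding v_def using K u(1)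
      by (intro ratsubfield_inverse ratsubfield_diff ratsubfield_mult ratsubfield_const)
    moreover have uv: "u = (ratconst \<alpha> - inverse v) / ratconst \<beta>"
      using False nz by (simp add: v_def)
    then have "u \<in> ratgen v"
      using ratsubfield_ratgen[of v] ratgen_self[of v]
      by (simp add: ratsubfield_divide ratsubfield_diff ratsubfield_const ratsubfield_inverse)
    then have "K \<subseteq> ratgen v"
      using gen ratgen_subset[OF ratsubfield_ratgen, of u v] by blast
    moreover have "v \<notin> range ratconst"
    proof
      assume "v \<in> range ratconst"
      then obtain y where "v = ratconst y" by blast
      then have "u = ratconst ((\<alpha> - inverse y) / \<beta>)" using uv by simp
      with u(2) show False by blast
    qed
    ultimately show ?thesis using that by blast
  qed
qed

text \<open>The Laurent polynomial \<open>u\<close> takes the value \<open>\<mu>\<close> at a non-zero point \<open>x\<close>; this is expressed by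
  divisibility of \<open>u - \<mu>\<close> by \<open>t - x\<close> in the ring of Laurent polynomials.\<close>

definition takes_value :: "'a::field_char_0 ratfun \<Rightarrow> 'a \<Rightarrow> bool" where
  "takes_value u \<mu> \<longleftrightarrow> (\<exists>x y. x \<noteq> 0 \<and> y \<in> laurent \<and> u - ratconst \<mu> = to_fract [:-x, 1:] * y)"

lemma linear_not_unit:
  assumes "x \<noteq> 0" "c \<noteq> 0" "y \<in> laurent"
  shows "to_fract [:-x, 1:] * y \<noteq> ratconst c"
proof
  assume eq: "to_fract [:-x, 1:] * y = ratconst c"
  obtain p m where "y = to_fract p / ratvar ^ m" using assms(3) by (rule laurent_cases)
  with eq have "to_fract [:-x, 1:] * to_fract p = ratconst c * ratvar ^ m"
    using ratvar_nz by (simp add: field_simps)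
  then have "to_fract ([:-x, 1:] * p) = to_fract (monom c m)"
    unfolding ev_ratvar[symmetric] by (simp add: algebra_simps)
  then have "[:-x, 1:] * p = monom c m" by (simp only: to_fract_eq_iff)
  from arg_cong[OF this, of "\<lambda>p. poly p x"] show False using assms(1,2) by (simp add: poly_monom)
qed

lemma monom_if_not_takes_value:
  fixes u :: "'a::{alg_closed_field,field_char_0} ratfun"
  assumes "u \<in> laurent" "u \<noteq> ratconst \<mu>" "\<not> takes_value u \<mu>"
  obtains c i m where "c \<noteq> 0" "u = ratconst \<mu> + ratconst c * ratvar ^ i / ratvar ^ m"
proof -
  have "u - ratconst \<mu> \<in> laurent" using assms(1) by (simp add: laurent_diff)
  then obtain p m where p: "u - ratconst \<mu> = to_fract p / ratvar ^ m" by (rule laurent_cases)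
  have "p \<noteq> 0" using p assms(2) by auto
  moreover have "poly p x \<noteq> 0" if "x \<noteq> 0" for x
  proof
    assume "poly p x = 0"
    then obtain q where "p = [:-x, 1:] * q" by (auto simp: poly_eq_0_iff_dvd elim!: dvdE)
    then have "u - ratconst \<mu> = to_fract [:-x, 1:] * (to_fract q / ratvar ^ m)"
      using p by (simp del: mult_pCons_left)
    then show False using assms(3) that laurentI unfolding takes_value_def by blast
  qed
  ultimately obtain c i where "c \<noteq> 0" "p = monom c i" by (rule monom_if_no_nonzero_root)
  then show ?thesis using that[of c i m] p unfolding ev_ratvar[symmetric] by (simp add: algebra_simps)
qed

text \<open>A Laurent polynomial that is a rational function of \<open>u\<close> has no pole at the values of \<open>u\<close>.\<close>

lemma ratgen_laurent_denominator:
  assumes b: "b \<in> ratgen u" "b \<in> laurent" and u: "u \<in> laurent"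
  obtains p q where "ev u q \<noteq> 0" "b = ev u p / ev u q" "\<And>\<mu>. takes_value u \<mu> \<Longrightarrow> poly q \<mu> \<noteq> 0"
proof -
  \<comment> \<open>A denominator of minimal degree has no root among the values of \<open>u\<close>: such a root is also a root of
    the numerator, and a linear factor cancels.\<close>
  define S where "S q \<longleftrightarrow> ev u q \<noteq> 0 \<and> (\<exists>p. b * ev u q = ev u p)" for q
  obtain p0 q0 where "b = ev u p0 / ev u q0" "ev u q0 \<noteq> 0" using b(1) by (rule ratgen_cases)
  then have "S q0" unfolding S_def by auto
  then obtain q where "S q" and min: "\<And>q'. S q' \<Longrightarrow> degree q \<le> degree q'"
    using ex_has_least_nat[of S q0 degree] by blast
  then obtain p where q: "ev u q \<noteq> 0" and pq: "b * ev u q = ev u p" by (auto simp: S_def)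
  have "poly q \<mu> \<noteq> 0" if tv: "takes_value u \<mu>" for \<mu>
  proof
    assume "poly q \<mu> = 0"
    then obtain q' where q': "q = [:-\<mu>, 1:] * q'" by (auto simp: poly_eq_0_iff_dvd elim!: dvdE)
    obtain x y where xy: "x \<noteq> 0" "y \<in> laurent" "u - ratconst \<mu> = to_fract [:-x, 1:] * y"
      using tv by (auto simp: takes_value_def)
    have lin: "ev u [:-\<mu>, 1:] = u - ratconst \<mu>" by simp
    define p' where "p' = synthetic_div p \<mu>"
    have "[:-\<mu>, 1:] * p' + [:poly p \<mu>:] = p"
      unfolding p'_def by (rule synthetic_div_correct'[symmetric, THEN sym])
    then have p': "ev u p = (u - ratconst \<mu>) * ev u p' + ratconst (poly p \<mu>)"
      by (metis ev_add ev_mult lin ev_pCons ev_0 mult_zero_right add_0_right)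
    have "ratconst (poly p \<mu>) = (u - ratconst \<mu>) * (b * ev u q' - ev u p')"
      using pq p' unfolding q' ev_mult lin by (simp add: algebra_simps)
    also have "\<dots> = to_fract [:-x, 1:] * (y * (b * ev u q' - ev u p'))"
      using xy(3) by (simp add: mult.assoc)
    finally have eq: "to_fract [:-x, 1:] * (y * (b * ev u q' - ev u p')) = ratconst (poly p \<mu>)" ..
    have yl: "y * (b * ev u q' - ev u p') \<in> laurent"
      using xy(2) b(2) u by (intro laurent_mult laurent_diff laurent_ev)
    then have "poly p \<mu> = 0" using linear_not_unit[OF xy(1) _ yl] eq by blast
    then have "(u - ratconst \<mu>) * (b * ev u q') = (u - ratconst \<mu>) * ev u p'"
      using pq p' unfolding q' ev_mult lin by (simp add: mult_ac)
    moreover have "u - ratconst \<mu> \<noteq> 0" "ev u q' \<noteq> 0" using q unfolding q' ev_mult lin by auto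
    ultimately have "S q'" unfolding S_def by auto
    moreover have "q' \<noteq> 0" using q q' by auto
    then have "degree q' < degree q" unfolding q' by (subst degree_mult_eq) auto
    ultimately show False using min[of q'] by simp
  qed
  then show ?thesis using that[of q p] q pq by (simp add: field_simps)
qed

lemma takes_value_power:
  fixes \<mu> :: "'a::{alg_closed_field,field_char_0}"
  assumes "n > 0" "\<mu> \<noteq> 0"
  shows "takes_value (ratvar ^ n) \<mu>"
proof -
  obtain x where x: "x ^ n = \<mu>" using nth_root_exists[of n \<mu>] assms(1) by auto
  have "poly (monom 1 n - [:\<mu>:]) x = 0" using x by (simp add: poly_monom)
  then obtain q where q: "monom 1 n - [:\<mu>:] = [:-x, 1:] * q"
    unfolding poly_eq_0_iff_dvd by (elim dvdE)
  have "ratvar ^ n - ratconst \<mu> = to_fract (monom 1 n - [:\<mu>:])"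
    by (simp add: ratvar_power ratconst_def)
  then have "ratvar ^ n - ratconst \<mu> = to_fract [:-x, 1:] * to_fract q"
    unfolding q to_fract_mult .
  moreover have "x \<noteq> 0" using x assms by auto
  ultimately show ?thesis unfolding takes_value_def using to_fract_laurent by blast
qed

lemma ratvar_power_nonconst:
  assumes "n > 0"
  shows "ratvar ^ n \<notin> range ratconst"
  using assms ratvar_nz by (simp flip: ddt_eq_0_iff add: ddt_power)

lemma laurent_subfield_cases:
  fixes K :: "'a::{alg_closed_field,field_char_0} ratfun set"
  assumes K: "ratsubfield K" and a: "a \<in> K" "a \<in> laurent" "a \<notin> range ratconst"
  obtains (single) s where "s \<notin> range ratconst" "K \<inter> laurent = adjoin {s}"
  | (power) n where "n > 0" "K \<inter> laurent = adjoin {ratvar ^ n, inverse (ratvar ^ n)}"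
proof -
  obtain u where u: "u \<in> K" "u \<in> laurent" "u \<notin> range ratconst" and gen: "K \<subseteq> ratgen u"
    using lueroth_laurent[OF K a] by blast
  have den: "\<exists>c. c \<noteq> 0 \<and> q = [:c:]" if "\<And>\<mu>. poly q \<mu> \<noteq> 0" for q :: "'a poly"
    using that alg_closed_imp_poly_has_root[of q] by (metis degree_eq_zeroE neq0_conv poly_const_conv)
  show ?thesis
  proof (cases "\<forall>\<mu>. takes_value u \<mu>")
    case True
    have "K \<inter> laurent \<subseteq> adjoin {u}"
    proof
      fix b assume b: "b \<in> K \<inter> laurent"
      then obtain p q where pq: "b = ev u p / ev u q" "\<And>\<mu>. takes_value u \<mu> \<Longrightarrow> poly q \<mu> \<noteq> 0"
        using gen u(2) by (metis IntD1 IntD2 ratgen_laurent_denominator subsetD)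
      then obtain c where "c \<noteq> 0" "q = [:c:]" using True den by blast
      then have "b = ev u (smult (inverse c) p)" using pq(1) by (simp add: field_simps)
      then show "b \<in> adjoin {u}" unfolding adjoin_single by blast
    qed
    moreover have "adjoin {u} \<subseteq> K \<inter> laurent"
      unfolding adjoin_single using u laurent_ev ratsubfield_ev[OF K] by auto
    ultimately show ?thesis using single u(3) by blast
  next
    case False
    then obtain \<mu> where "\<not> takes_value u \<mu>" by blast
    moreover have "u \<noteq> ratconst \<mu>" using u(3) by blast
    ultimately obtain c i m where c: "c \<noteq> 0" "u = ratconst \<mu> + ratconst c * ratvar ^ i / ratvar ^ m"
      using u(2) by (metis monom_if_not_takes_value)
    define w where "w = (u - ratconst \<mu>) / ratconst c"
    have w: "w = ratvar ^ i / ratvar ^ m" using c by (simp add: w_def)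
    have wK: "w \<in> K" using K u(1) unfolding w_def
      by (intro ratsubfield_divide ratsubfield_diff ratsubfield_const)
    have im: "i \<noteq> m"
    proof
      assume "i = m"
      then have "u = ratconst (\<mu> + c)" using c ratvar_nz by simp
      with u(3) show False by blast
    qed
    define n where "n = (if i > m then i - m else m - i)"
    have n: "n > 0" using im by (auto simp: n_def)
    define s where "s = (ratvar :: 'a ratfun) ^ n"
    have s0: "s \<noteq> 0" using ratvar_nz by (simp add: s_def)
    have ws: "w = s \<or> w = inverse s"
      using im ratvar_nz unfolding w s_def n_def
      by (auto simp: field_simps simp flip: power_add)
    then have sK: "s \<in> K" using wK ratsubfield_inverse[OF K wK] by auto
    have "u \<in> ratgen s"
    proof -
      note L = ratsubfield_ratgen[of s]
      have "w \<in> ratgen s" using ws ratgen_self[of s] ratsubfield_inverse[OF L] by auto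
      moreover have "u = ratconst \<mu> + ratconst c * w" using c by (simp add: w_def)
      ultimately show ?thesis
        using L by (auto intro!: ratsubfield_add ratsubfield_mult ratsubfield_const)
    qed
    then have gen': "K \<subseteq> ratgen s" using gen ratgen_subset[OF ratsubfield_ratgen] by blast
    have sL: "s \<in> laurent" by (simp add: s_def laurent_power)
    have "K \<inter> laurent \<subseteq> adjoin {s, inverse s}"
    proof
      fix b assume b: "b \<in> K \<inter> laurent"
      then obtain p q where pq: "ev s q \<noteq> 0" "b = ev s p / ev s q"
          "\<And>\<mu>. takes_value s \<mu> \<Longrightarrow> poly q \<mu> \<noteq> 0"
        using gen' sL by (metis IntD1 IntD2 ratgen_laurent_denominator subsetD)
      have "q \<noteq> 0" using pq(1) by auto
      moreover have "poly q x \<noteq> 0" if "x \<noteq> 0" for x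
        using pq(3) takes_value_power[OF n that] by (simp add: s_def)
      ultimately obtain c j where "c \<noteq> 0" "q = monom c j" by (rule monom_if_no_nonzero_root)
      then have "b = ev s (smult (inverse c) p) / s ^ j" using pq(2) by (simp add: field_simps)
      then show "b \<in> adjoin {s, inverse s}" unfolding adjoin_inverse[OF s0] by blast
    qed
    moreover have invs: "inverse s \<in> laurent"
      using laurent_power[OF laurent_inverse_ratvar, of n] by (simp add: s_def power_inverse)
    have "ev s p / s ^ j \<in> K \<inter> laurent" for p j
      using ratsubfield_divide[OF K ratsubfield_ev[OF K sK] ratsubfield_power[OF K sK], of p j]
        laurent_mult[OF laurent_ev[OF sL] laurent_power[OF invs], of p j]
      by (simp add: divide_inverse power_inverse)
    then have "adjoin {s, inverse s} \<subseteq> K \<inter> laurent"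
      unfolding adjoin_inverse[OF s0] by blast
    ultimately show ?thesis using power[OF n] unfolding s_def by blast
  qed
qed

section \<open>Finite codimension\<close>

text \<open>In the definition of finite codimension the complement may be spanned by any finite set, not
  only by a subset of the larger space.\<close>

lemma has_finite_codim_inI:
  assumes "ratop.subspace h" "ratop.subspace g" "h \<subseteq> g" "finite F"
    and decomp: "\<And>D. D \<in> g \<Longrightarrow> \<exists>E\<in>ratop.span F. D - E \<in> h"
  shows "has_finite_codim_in h g"
proof -
  obtain B where B: "B \<subseteq> g \<inter> ratop.span F" "ratop.independent B" "g \<inter> ratop.span F \<subseteq> ratop.span B"
    using ratop.basis_exists[of "g \<inter> ratop.span F"] by metis
  have "finite B" using ratop.independent_span_bound[OF assms(4) B(2)] B(1) by blast
  moreover have "\<exists>E\<in>ratop.span B. D - E \<in> h" if D: "D \<in> g" for D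
  proof -
    obtain E where E: "E \<in> ratop.span F" "D - E \<in> h" using decomp[OF D] by blast
    then have "D - (D - E) \<in> g" using assms(2,3) D by (blast intro: ratop.subspace_diff)
    then have "E \<in> ratop.span B" using E(1) B(3) by auto
    with E(2) show ?thesis by blast
  qed
  ultimately show ?thesis using assms(3) B(1) unfolding has_finite_codim_in_def by blast
qed

lemma has_finite_codim_in_trans:
  assumes "has_finite_codim_in h g" "has_finite_codim_in g k"
  shows "has_finite_codim_in h k"
proof -
  obtain B where B: "finite B" "B \<subseteq> g" "\<And>D. D \<in> g \<Longrightarrow> \<exists>E\<in>ratop.span B. D - E \<in> h"
    using assms(1) unfolding has_finite_codim_in_def by blast
  obtain C where C: "finite C" "C \<subseteq> k" "\<And>D. D \<in> k \<Longrightarrow> \<exists>E\<in>ratop.span C. D - E \<in> g"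
    using assms(2) unfolding has_finite_codim_in_def by blast
  have "\<exists>E\<in>ratop.span (B \<union> C). D - E \<in> h" if D: "D \<in> k" for D
  proof -
    obtain E where E: "E \<in> ratop.span C" "D - E \<in> g" using C(3)[OF D] by blast
    obtain E' where E': "E' \<in> ratop.span B" "D - E - E' \<in> h" using B(3)[OF E(2)] by blast
    have "E + E' \<in> ratop.span (B \<union> C)"
      using E(1) E'(1) by (meson Un_upper1 Un_upper2 ratop.span_add ratop.span_mono subsetD)
    then show ?thesis using E'(2) by (metis diff_diff_add)
  qed
  moreover have "h \<subseteq> k" "B \<union> C \<subseteq> k"
    using assms B(2) C(2) unfolding has_finite_codim_in_def by auto
  ultimately show ?thesis using B(1) C(1) unfolding has_finite_codim_in_def by blast
qed

lemma ev_eq_sum: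
  assumes "\<And>i. i \<ge> N \<Longrightarrow> coeff r i = 0"
  shows "ev s r = (\<Sum>i<N. ratconst (coeff r i) * s ^ i)"
  using assms
proof (induction N arbitrary: r)
  case 0
  then have "r = 0" by (intro poly_eqI) auto
  then show ?case by simp
next
  case (Suc N)
  obtain a q where r: "r = pCons a q" by (cases r)
  have "coeff q i = 0" if "i \<ge> N" for i
    using Suc.prems[of "Suc i"] that by (simp add: r)
  then have "ev s q = (\<Sum>i<N. ratconst (coeff q i) * s ^ i)" by (rule Suc.IH)
  then show ?case unfolding sum.lessThan_Suc_shift
    by (simp add: r sum_distrib_left mult_ac)
qed

lemma vf_sum: "vf (\<Sum>i\<in>A. f i) = (\<Sum>i\<in>A. vf (f i))"
  by (induction A rule: infinite_finite_induct) (simp_all add: vf_add vf_0)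

text \<open>The remainders modulo a non-zero polynomial form a finite-dimensional space.\<close>

lemma vf_remainder_in_span:
  assumes "\<psi> \<noteq> 0"
  shows "vf (ev s (p mod \<psi>) * e) \<in> ratop.span ((\<lambda>i. vf (s ^ i * e)) ` {..<degree \<psi>})"
proof -
  have "coeff (p mod \<psi>) i = 0" if "i \<ge> degree \<psi>" for i
    using that degree_mod_less[OF assms, of p] by (auto simp: coeff_eq_0)
  then have "ev s (p mod \<psi>) = (\<Sum>i<degree \<psi>. ratconst (coeff (p mod \<psi>) i) * s ^ i)"
    by (rule ev_eq_sum)
  then have eq: "vf (ev s (p mod \<psi>) * e) = (\<Sum>i<degree \<psi>. ratop_scale (coeff (p mod \<psi>) i) (vf (s ^ i * e)))"
    by (simp add: sum_distrib_right vf_sum mult.assoc flip: vf_scale)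
  show ?thesis unfolding eq by (intro ratop.span_sum ratop.span_scale ratop.span_base) auto
qed

lemma finite_codim_polynomial:
  assumes "ratop.subspace h" "ratop.subspace g" "h \<subseteq> g" "\<psi> \<noteq> 0"
    and g: "g \<subseteq> {vf (ev s p * e) | p. True}"
    and h: "\<And>p. vf (ev s (\<psi> * p) * e) \<in> h"
  shows "has_finite_codim_in h g"
proof (rule has_finite_codim_inI)
  fix D assume "D \<in> g"
  then obtain p where D: "D = vf (ev s p * e)" using g by blast
  have "ev s p = ev s (\<psi> * (p div \<psi>)) + ev s (p mod \<psi>)"
    unfolding ev_add[symmetric] by simp
  then have "D - vf (ev s (p mod \<psi>) * e) = vf (ev s (\<psi> * (p div \<psi>)) * e)"
    by (simp add: D algebra_simps flip: vf_diff)
  then show "\<exists>E\<in>ratop.span ((\<lambda>i. vf (s ^ i * e)) ` {..<degree \<psi>}). D - E \<in> h"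
    using vf_remainder_in_span[OF assms(4), of s p e] h by metis
qed (use assms in auto)

text \<open>The same for Laurent polynomials: if \<open>\<psi>\<close> has a non-zero constant term, then \<open>s\<close> is invertible modulo
  \<open>\<psi>(s)\<close>, and every Laurent polynomial is congruent to a polynomial.\<close>

lemma finite_codim_laurent:
  assumes "ratop.subspace h" "ratop.subspace g" "h \<subseteq> g" "coeff \<psi> 0 \<noteq> 0" "s \<noteq> 0"
    and g: "g \<subseteq> {vf (y * e) | y. y \<in> adjoin {s, inverse s}}"
    and h: "\<And>y. y \<in> adjoin {s, inverse s} \<Longrightarrow> vf (ev s \<psi> * y * e) \<in> h"
  shows "has_finite_codim_in h g"
proof (rule has_finite_codim_inI)
  have \<psi>: "\<psi> \<noteq> 0" using assms(4) by auto
  have "\<exists>q y. y \<in> adjoin {s, inverse s} \<and> ev s p / s ^ m = ev s q + ev s \<psi> * y" for p m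
  proof (induction m arbitrary: p)
    case 0
    show ?case by (intro exI[of _ p] exI[of _ 0]) simp
  next
    case (Suc m)
    \<comment> \<open>A multiple of \<open>\<psi>\<close> cancels the constant term.\<close>
    define c where "c = coeff p 0 / coeff \<psi> 0"
    have "coeff (p - smult c \<psi>) 0 = 0" using assms(4) by (simp add: c_def)
    then obtain q where "p - smult c \<psi> = pCons 0 q" by (metis coeff_pCons_0 pCons_cases)
    then have "ev s p = ratconst c * ev s \<psi> + s * ev s q"
      by (metis add.commute add_0 diff_add_cancel ev_add ev_pCons ev_smult ratconst_0)
    then have "ev s p / s ^ Suc m = ev s q / s ^ m + ev s \<psi> * (ev s [:c:] / s ^ Suc m)"
      using assms(5) by (simp add: field_simps)
    moreover obtain q' y where "y \<in> adjoin {s, inverse s}" "ev s q / s ^ m = ev s q' + ev s \<psi> * y"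
      using Suc.IH by blast
    moreover have "ev s [:c:] / s ^ Suc m \<in> adjoin {s, inverse s}"
      unfolding adjoin_inverse[OF assms(5)] by blast
    ultimately have "y + ev s [:c:] / s ^ Suc m \<in> adjoin {s, inverse s}"
        "ev s p / s ^ Suc m = ev s q' + ev s \<psi> * (y + ev s [:c:] / s ^ Suc m)"
      by (simp_all add: adjoin.add distrib_left)
    then show ?case by blast
  qed note reduce = this
  fix D assume "D \<in> g"
  then obtain z where z: "D = vf (z * e)" "z \<in> adjoin {s, inverse s}" using g by blast
  then obtain p m where D: "D = vf (ev s p / s ^ m * e)" unfolding adjoin_inverse[OF assms(5)] by blast
  obtain q y where y: "y \<in> adjoin {s, inverse s}" and eq: "ev s p / s ^ m = ev s q + ev s \<psi> * y"
    using reduce by blast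
  have q: "ev s q = ev s \<psi> * ev s (q div \<psi>) + ev s (q mod \<psi>)"
    unfolding ev_mult[symmetric] ev_add[symmetric] by simp
  have "D - vf (ev s (q mod \<psi>) * e) = vf (ev s \<psi> * (ev s (q div \<psi>) + y) * e)"
    unfolding D eq q by (simp add: algebra_simps flip: vf_diff)
  moreover have "ev s (q div \<psi>) + y \<in> adjoin {s, inverse s}"
    using y by (intro adjoin.add ev_in_adjoin) (auto intro: adjoin.gen)
  ultimately show "\<exists>E\<in>ratop.span ((\<lambda>i. vf (s ^ i * e)) ` {..<degree \<psi>}). D - E \<in> h"
    using vf_remainder_in_span[OF \<psi>, of s q e] h by metis
qed (use assms in auto)

section \<open>Change of variable\<close>

text \<open>The embedding of the field of rational functions into itself that sends the variable to the
  non-constant element \<open>s\<close>; the value does not depend on the representation as a fraction.\<close>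

definition subst :: "'a::field_char_0 ratfun \<Rightarrow> 'a ratfun \<Rightarrow> 'a ratfun" where
  "subst s x = (THE z. \<exists>p q. q \<noteq> 0 \<and> x = Fract p q \<and> z = ev s p / ev s q)"

context
  fixes s :: "'a::field_char_0 ratfun"
  assumes s: "s \<notin> range ratconst"
begin

lemma subst_Fract:
  assumes "q \<noteq> 0"
  shows "subst s (Fract p q) = ev s p / ev s q"
  unfolding subst_def
proof (rule the_equality)
  fix z assume "\<exists>p' q'. q' \<noteq> 0 \<and> Fract p q = Fract p' q' \<and> z = ev s p' / ev s q'"
  then obtain p' q' where *: "q' \<noteq> 0" "Fract p q = Fract p' q'" "z = ev s p' / ev s q'" by blast
  then have "p * q' = p' * q" using assms by (simp add: eq_fract)
  then have "ev s p * ev s q' = ev s p' * ev s q" by (simp flip: ev_mult)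
  then show "z = ev s p / ev s q" using * assms ev_eq_0_iff[OF s] by (simp add: frac_eq_eq)
qed (use assms in blast)

lemma subst_to_fract [simp]: "subst s (to_fract p) = ev s p"
  unfolding to_fract_def by (simp add: subst_Fract)

lemma subst_ratconst [simp]: "subst s (ratconst c) = ratconst c"
  using subst_to_fract[of "[:c:]"] by (simp flip: ratconst_def)

lemma subst_ratvar [simp]: "subst s ratvar = s"
  unfolding ratvar_def by simp

lemma subst_add: "subst s (x + y) = subst s x + subst s y"
proof (cases x; cases y)
  fix p q p' q' assume *: "x = Fract p q" "q \<noteq> 0" "y = Fract p' q'" "q' \<noteq> 0"
  then show ?thesis
    using ev_eq_0_iff[OF s] by (simp add: subst_Fract add_frac_eq mult.commute)
qed

lemma subst_mult: "subst s (x * y) = subst s x * subst s y"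
proof (cases x; cases y)
  fix p q p' q' assume *: "x = Fract p q" "q \<noteq> 0" "y = Fract p' q'" "q' \<noteq> 0"
  then show ?thesis by (simp add: subst_Fract)
qed

lemma subst_eq_0_iff [simp]: "subst s x = 0 \<longleftrightarrow> x = 0"
proof (cases x)
  case (Fract p q)
  have "Fract p q = 0 \<longleftrightarrow> p = 0" using Fract(2) by (simp add: Zero_fract_def eq_fract)
  then show ?thesis using Fract by (simp add: subst_Fract ev_eq_0_iff[OF s])
qed

lemma subst_0 [simp]: "subst s 0 = 0" and subst_1 [simp]: "subst s 1 = 1"
  using subst_ratconst[of 1] by (simp_all del: subst_ratconst)

lemma subst_diff: "subst s (x - y) = subst s x - subst s y"
  using subst_add[of "x - y" y] by simp

lemma subst_inject: "subst s x = subst s y \<longleftrightarrow> x = y"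
  using subst_eq_0_iff[of "x - y"] by (simp add: subst_diff)

lemma subst_inverse: "subst s (inverse x) = inverse (subst s x)"
proof (cases "x = 0")
  case True then show ?thesis by simp
next
  case False
  then have "subst s x * subst s (inverse x) = 1" by (simp flip: subst_mult)
  then show ?thesis by (metis inverse_unique)
qed

text \<open>The chain rule.\<close>

lemma ddt_subst: "ddt (subst s x) = subst s (ddt x) * ddt s"
proof (cases x)
  case (Fract p q)
  have nz: "ev s q \<noteq> 0" using Fract(2) ev_eq_0_iff[OF s] by simp
  have "ddt (subst s x) = ddt (ev s p / ev s q)" by (simp add: Fract subst_Fract)
  also have "\<dots> = subst s (ddt x) * ddt s"
    using Fract nz by (simp add: ddt_Fract subst_Fract ddt_divide ddt_ev algebra_simps diff_divide_distrib)
  finally show ?thesis .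
qed

lemma subst_adjoin: "subst s ` adjoin S = adjoin (subst s ` S)"
proof (intro equalityI subsetI)
  fix y assume "y \<in> adjoin (subst s ` S)"
  then show "y \<in> subst s ` adjoin S"
  proof induction
    case (gen y) then show ?case by (auto intro: adjoin.gen)
  next
    case (const c) show ?case using imageI[OF adjoin.const, of "subst s" c] by simp
  next
    case (add x y) then show ?case by (auto simp flip: subst_add intro: adjoin.add)
  next
    case (mult x y) then show ?case by (auto simp flip: subst_mult intro: adjoin.mult)
  qed
next
  have "subst s x \<in> adjoin (subst s ` S)" if "x \<in> adjoin S" for x
    using that
  proof induction
    case (add x y) then show ?case by (simp add: subst_add adjoin.add)
  next
    case (mult x y) then show ?case by (simp add: subst_mult adjoin.mult)
  qed (auto intro: adjoin.intros)
  then show "y \<in> subst s ` adjoin S \<Longrightarrow> y \<in> adjoin (subst s ` S)" for y by blast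
qed

end

text \<open>The vector field \<open>f \<partial>\<close> read in the variable \<open>s\<close>, that is \<open>f(s) / s' \<partial>\<close>.\<close>

definition change_var :: "'a::field_char_0 ratfun \<Rightarrow> 'a ratop \<Rightarrow> 'a ratop" where
  "change_var s D = vf (subst s (D ratvar) / ddt s)"

lemma change_var_vf: "change_var s (vf f) = vf (subst s f / ddt s)"
  by (simp add: change_var_def vf_def)

context
  fixes s :: "'a::field_char_0 ratfun"
  assumes s: "s \<notin> range ratconst"
begin

lemma ddt_s_nz: "ddt s \<noteq> 0" using s by (simp add: ddt_eq_0_iff)

lemma change_var_add: "change_var s (D + E) = change_var s D + change_var s E"
  by (simp add: change_var_def subst_add[OF s] add_divide_distrib vf_add)

lemma change_var_scale: "change_var s (ratop_scale c D) = ratop_scale c (change_var s D)"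
  by (simp add: change_var_def ratop_scale_def[of c D] subst_mult[OF s] subst_ratconst[OF s] flip: vf_scale)

lemma change_var_diff: "change_var s (D - E) = change_var s D - change_var s E"
  by (simp add: change_var_def subst_diff[OF s] diff_divide_distrib vf_diff)

lemma change_var_0: "change_var s 0 = 0"
  using change_var_add[of 0 0] by simp

lemma change_var_bracket:
  "change_var s (lie_bracket (vf f) (vf g)) = lie_bracket (change_var s (vf f)) (change_var s (vf g))"
  using ddt_s_nz unfolding change_var_vf lie_bracket_vf
  by (simp add: ddt_divide ddt_subst[OF s] subst_diff[OF s] subst_mult[OF s] field_simps)

lemma change_var_inject: "change_var s (vf f) = change_var s (vf g) \<longleftrightarrow> f = g"
  using ddt_s_nz by (simp add: change_var_vf subst_inject[OF s])

lemma change_var_span: "ratop.span (change_var s ` B) = change_var s ` ratop.span B"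
proof (rule module_hom.span_image[where ?s1.0 = ratop_scale and ?s2.0 = ratop_scale])
  show "module_hom ratop_scale ratop_scale (change_var s)"
    by unfold_locales (simp_all add: change_var_add change_var_scale ratop.scale_right_distrib
        ratop.scale_left_distrib)
qed

text \<open>A Lie algebra of finite codimension in the image of the vector fields with coefficients in \<open>A\<close>
  is isomorphic to its inverse image.\<close>

lemma change_var_pullback:
  assumes A: "range ratconst \<subseteq> A" "\<And>f g. f \<in> A \<Longrightarrow> g \<in> A \<Longrightarrow> f + g \<in> A \<and> f * g \<in> A"
    and A_ddt: "\<And>f. f \<in> A \<Longrightarrow> ddt f \<in> A"
    and g: "ratop.subspace g" "\<And>D E. D \<in> g \<Longrightarrow> E \<in> g \<Longrightarrow> lie_bracket D E \<in> g"
    and codim: "has_finite_codim_in g (change_var s ` vf ` A)"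
  shows "\<exists>h. lie_subalgebra h (vf ` A) \<and> has_finite_codim_in h (vf ` A) \<and> lie_isomorphic g h"
proof -
  have A_scale: "ratconst c * f \<in> A" if "f \<in> A" for c f using A that by blast
  have A_diff: "f - f' \<in> A" if "f \<in> A" "f' \<in> A" for f f'
  proof -
    have "f + ratconst (-1) * f' \<in> A" using A(2) A_scale that by blast
    then show ?thesis by simp
  qed
  have A_space: "ratop.subspace (vf ` A)"
  proof (rule ratop.subspaceI)
    have "ratconst 0 \<in> A" using A(1) by blast
    then show "0 \<in> vf ` A" by (metis image_eqI ratconst_0 vf_0)
  qed (use A(2) A_scale in \<open>auto simp flip: vf_add vf_scale\<close>)
  define h where "h = {D \<in> vf ` A. change_var s D \<in> g}"
  have g_image: "g \<subseteq> change_var s ` vf ` A" using codim by (simp add: has_finite_codim_in_def)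
  have h_space: "ratop.subspace h"
    using A_space g(1) unfolding h_def
    by (auto simp: ratop.subspace_def change_var_add change_var_scale change_var_0)
  have "lie_bracket D E \<in> h" if DE: "D \<in> h" "E \<in> h" for D E
  proof -
    obtain a b where ab: "D = vf a" "E = vf b" "a \<in> A" "b \<in> A" using DE by (auto simp: h_def)
    then have "a * ddt b - b * ddt a \<in> A" by (intro A_diff conjunct2[OF A(2)] A_ddt)
    then have "lie_bracket D E \<in> vf ` A" by (simp add: ab lie_bracket_vf)
    moreover have "change_var s D \<in> g" "change_var s E \<in> g" using DE by (simp_all add: h_def)
    then have "change_var s (lie_bracket D E) \<in> g"
      unfolding ab change_var_bracket by (rule g(2))
    ultimately show ?thesis by (simp add: h_def)
  qed
  then have h_lie: "lie_subalgebra h (vf ` A)"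
    using h_space by (auto simp: lie_subalgebra_def h_def)
  have h_codim: "has_finite_codim_in h (vf ` A)"
  proof -
    obtain B where B: "finite B" "B \<subseteq> change_var s ` vf ` A"
        "\<forall>D\<in>change_var s ` vf ` A. \<exists>E\<in>ratop.span B. D - E \<in> g"
      using codim unfolding has_finite_codim_in_def by (elim conjE exE) (rule that; assumption)
    obtain C where C: "C \<subseteq> vf ` A" "finite C" "B = change_var s ` C"
      using finite_subset_image[OF B(1,2)] by (elim conjE exE) (rule that; assumption)
    have "\<exists>E\<in>ratop.span C. D - E \<in> h" if D: "D \<in> vf ` A" for D
    proof -
      obtain E where E: "E \<in> ratop.span C" "change_var s D - change_var s E \<in> g"
        using bspec[OF B(3) imageI[OF D]] unfolding C(3) change_var_span by (elim bexE imageE) simp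
      have "E \<in> vf ` A" by (rule subsetD[OF ratop.span_minimal[OF C(1) A_space] E(1)])
      then have "D - E \<in> vf ` A" using D by (intro ratop.subspace_diff[OF A_space])
      then have "D - E \<in> h" using E(2) by (simp add: h_def change_var_diff)
      then show ?thesis using E(1) by blast
    qed
    moreover have "h \<subseteq> vf ` A" by (simp add: h_def)
    ultimately show ?thesis
      unfolding has_finite_codim_in_def using C(1,2) by (intro conjI exI[of _ C] ballI)
  qed
  have inj: "inj_on (change_var s) h"
    by (rule inj_onI) (auto simp: h_def change_var_inject)
  have img: "change_var s ` h = g" using g_image by (auto simp: h_def)
  define \<phi> where "\<phi> = the_inv_into h (change_var s)"
  have \<phi>: "\<phi> (change_var s D) = D" if "D \<in> h" for D
    unfolding \<phi>_def by (rule the_inv_into_f_f[OF inj that])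
  have "bij_betw \<phi> g h"
    unfolding \<phi>_def img[symmetric] by (rule bij_betw_the_inv_into) (simp add: bij_betw_def inj)
  moreover have "\<phi> (D + E) = \<phi> D + \<phi> E" if DE: "D \<in> g" "E \<in> g" for D E
  proof -
    obtain D' E' where "D = change_var s D'" "E = change_var s E'" "D' \<in> h" "E' \<in> h" using DE img by blast
    then show ?thesis using \<phi> ratop.subspace_add[OF h_space] by (simp flip: change_var_add)
  qed
  moreover have "\<phi> (ratop_scale c D) = ratop_scale c (\<phi> D)" if D: "D \<in> g" for c D
  proof -
    obtain D' where "D = change_var s D'" "D' \<in> h" using D img by blast
    then show ?thesis using \<phi> ratop.subspace_scale[OF h_space] by (simp flip: change_var_scale)
  qed
  moreover have "\<phi> (lie_bracket D E) = lie_bracket (\<phi> D) (\<phi> E)" if DE: "D \<in> g" "E \<in> g" for D E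
  proof -
    obtain D' E' where D': "D = change_var s D'" "E = change_var s E'" "D' \<in> h" "E' \<in> h"
      using DE img by blast
    then have "change_var s (lie_bracket D' E') = lie_bracket D E"
      using change_var_bracket by (auto simp: h_def)
    moreover have "lie_bracket D' E' \<in> h" using h_lie D' by (simp add: lie_subalgebra_def)
    ultimately show ?thesis using \<phi> D' by metis
  qed
  ultimately have "lie_isomorphic g h" unfolding lie_isomorphic_def by blast
  with h_lie h_codim show ?thesis by blast
qed

end

lemma veronese_eq_change_var:
  assumes "n > 0"
  shows "veronese n = change_var (ratvar ^ n) ` (witt :: 'a::field_char_0 ratop set)"
proof -
  define s where "s = (ratvar :: 'a ratfun) ^ n"
  have s: "s \<notin> range ratconst" unfolding s_def by (rule ratvar_power_nonconst[OF assms])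
  have img: "subst s ` laurent = adjoin {s, inverse s}"
    unfolding laurent_def subst_adjoin[OF s] by (simp add: subst_inverse[OF s] subst_ratvar[OF s])
  have ds: "ddt s * ratvar = of_nat n * s"
    using power_minus_mult[OF assms, of "ratvar :: 'a ratfun"] by (simp add: s_def ddt_power mult.assoc)
  have nz: "ddt s \<noteq> 0" "s \<noteq> 0" "of_nat n \<noteq> (0 :: 'a ratfun)"
    using s assms by (auto simp: ddt_eq_0_iff s_def)
  have "change_var s ` witt = {vf (f / ddt s) | f. f \<in> adjoin {s, inverse s}}"
    unfolding witt_def image_image change_var_vf img[symmetric] by auto
  also have "\<dots> = {vf (f * ratvar) | f. f \<in> adjoin {s, inverse s}}"
  proof (intro equalityI subsetI)
    fix D assume "D \<in> {vf (f / ddt s) | f. f \<in> adjoin {s, inverse s}}"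
    then obtain f where f: "D = vf (f / ddt s)" "f \<in> adjoin {s, inverse s}" by blast
    have "ratconst (1 / of_nat n) * (f * inverse s) \<in> adjoin {s, inverse s}"
      using f(2) by (intro adjoin.mult adjoin.const) (auto intro: adjoin.gen)
    moreover have "D = vf (ratconst (1 / of_nat n) * (f * inverse s) * ratvar)"
      unfolding f(1) vf_inject using ds nz by (simp add: field_simps)
    ultimately show "D \<in> {vf (f * ratvar) | f. f \<in> adjoin {s, inverse s}}" by blast
  next
    fix D assume "D \<in> {vf (f * ratvar) | f. f \<in> adjoin {s, inverse s}}"
    then obtain f where f: "D = vf (f * ratvar)" "f \<in> adjoin {s, inverse s}" by blast
    have "ratconst (of_nat n) * (f * s) \<in> adjoin {s, inverse s}"
      using f(2) by (intro adjoin.mult adjoin.const) (auto intro: adjoin.gen)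
    moreover have "D = vf (ratconst (of_nat n) * (f * s) / ddt s)"
      unfolding f(1) vf_inject using ds nz by (simp add: field_simps)
    ultimately show "D \<in> {vf (f / ddt s) | f. f \<in> adjoin {s, inverse s}}" by blast
  qed
  finally show ?thesis by (simp add: veronese_def s_def)
qed

lemma der_adjoin_eq_change_var:
  assumes "s \<notin> range ratconst"
  shows "der_adjoin s = change_var s ` witt1"
proof -
  have "adjoin {s} = subst s ` adjoin {ratvar}"
    by (simp add: subst_adjoin[OF assms] subst_ratvar[OF assms])
  then show ?thesis unfolding der_adjoin_def witt1_def image_image change_var_vf by auto
qed

text \<open>Every non-zero polynomial divides, in the ring of Laurent polynomials, some non-zero polynomial
  in \<open>u\<close>: a product of factors \<open>u - u(x)\<close>, with \<open>x\<close> running through the roots.\<close>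

lemma laurent_multiple_in_adjoin:
  fixes u :: "'a::{alg_closed_field,field_char_0} ratfun"
  assumes u: "u \<in> laurent" and "p \<noteq> 0"
  shows "\<exists>\<psi> y. \<psi> \<noteq> 0 \<and> y \<in> laurent \<and> ev u \<psi> = to_fract p * y"
  using assms(2)
proof (induction "degree p" arbitrary: p)
  case 0
  then obtain c where c: "p = [:c:]" "c \<noteq> 0" by (metis degree_eq_zeroE pCons_0_0)
  have "ev u [:c:] = to_fract p * 1" by (simp add: c ratconst_def)
  moreover have "[:c:] \<noteq> 0" using c by simp
  ultimately show ?case using laurent_1 by blast
next
  case (Suc n)
  then obtain x where "poly p x = 0" using alg_closed_imp_poly_has_root[of p] by auto
  then obtain p1 where p1: "p = [:-x, 1:] * p1" unfolding poly_eq_0_iff_dvd by (elim dvdE)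
  with Suc.prems have "p1 \<noteq> 0" by auto
  moreover from this have "n = degree p1" using Suc.hyps(2) unfolding p1 by (subst (asm) degree_mult_eq) auto
  ultimately obtain \<psi> y where IH: "\<psi> \<noteq> 0" "y \<in> laurent" "ev u \<psi> = to_fract p1 * y"
    using Suc.hyps(1) by blast
  show ?case
  proof (cases "x = 0")
    case True
    then have "ev u \<psi> = to_fract p * (y * inverse ratvar)"
      unfolding p1 to_fract_mult using IH(3) by (simp add: ratvar_def flip: ratvar_def)
    then show ?thesis using IH laurent_mult[OF IH(2) laurent_inverse_ratvar] by blast
  next
    case False
    obtain q m where q: "u = to_fract q / ratvar ^ m" using u by (rule laurent_cases)
    define \<mu> where "\<mu> = poly q x / x ^ m"
    have "poly (q - smult \<mu> (monom 1 m)) x = 0" using False by (simp add: \<mu>_def poly_monom)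
    then obtain r where r: "q - smult \<mu> (monom 1 m) = [:-x, 1:] * r"
      unfolding poly_eq_0_iff_dvd by (elim dvdE)
    have "ev u [:-\<mu>, 1:] = to_fract (q - smult \<mu> (monom 1 m)) / ratvar ^ m"
      unfolding q by (simp add: diff_divide_distrib flip: ev_ratvar)
    then have "ev u [:-\<mu>, 1:] = to_fract [:-x, 1:] * (to_fract r / ratvar ^ m)"
      unfolding r to_fract_mult by simp
    then have "ev u ([:-\<mu>, 1:] * \<psi>) = to_fract p * (to_fract r / ratvar ^ m * y)"
      unfolding p1 ev_mult IH(3) to_fract_mult by (simp only: mult_ac)
    moreover have "[:-\<mu>, 1:] * \<psi> \<noteq> 0" using IH(1) by (simp del: mult_pCons_left)
    ultimately show ?thesis using laurent_mult[OF laurentI IH(2)] by blast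
  qed
qed

lemma subspace_witt: "ratop.subspace witt"
proof (rule ratop.subspaceI)
  show "0 \<in> witt" unfolding witt_def by (metis image_eqI laurent_0 vf_0)
qed (auto simp: witt_def laurent_add laurent_mult simp flip: vf_add vf_scale)

lemma subspace_der_adjoin: "ratop.subspace (der_adjoin s)"
proof (rule ratop.subspaceI)
  have "0 = vf (0 / ddt s)" by (simp add: vf_0)
  then show "0 \<in> der_adjoin s" unfolding der_adjoin_def using adjoin_0 by blast
next
  fix D E assume "D \<in> der_adjoin s" "E \<in> der_adjoin s"
  then obtain a b where "D = vf (a / ddt s)" "E = vf (b / ddt s)" "a \<in> adjoin {s}" "b \<in> adjoin {s}"
    by (auto simp: der_adjoin_def)
  then have "D + E = vf ((a + b) / ddt s)" "a + b \<in> adjoin {s}"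
    by (auto simp: add_divide_distrib vf_add adjoin.add)
  then show "D + E \<in> der_adjoin s" unfolding der_adjoin_def by blast
next
  fix c D assume "D \<in> der_adjoin s"
  then obtain a where "D = vf (a / ddt s)" "a \<in> adjoin {s}" by (auto simp: der_adjoin_def)
  then have "ratop_scale c D = vf ((ratconst c * a) / ddt s)" "ratconst c * a \<in> adjoin {s}"
    by (auto simp: adjoin.mult adjoin.const simp flip: vf_scale)
  then show "ratop_scale c D \<in> der_adjoin s" unfolding der_adjoin_def by blast
qed

lemma subspace_witt_sub: "ratop.subspace (witt_sub s)"
  unfolding witt_sub_def by (rule ratop.subspace_inter[OF subspace_witt subspace_der_adjoin])

lemma der_adjoin_subset: "der_adjoin s \<subseteq> {vf (ev s p * inverse (ddt s)) | p. True}"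
  unfolding der_adjoin_def adjoin_single by (auto simp: divide_inverse)

lemma witt_sub_finite_codim:
  fixes s :: "'a::{alg_closed_field,field_char_0} ratfun"
  assumes "s \<in> laurent" "s \<notin> range ratconst"
  shows "has_finite_codim_in (witt_sub s) (der_adjoin s)"
proof -
  obtain p m where p: "ddt s = to_fract p / ratvar ^ m"
    using laurent_ddt[OF assms(1)] by (rule laurent_cases)
  have nz: "ddt s \<noteq> 0" using assms(2) by (simp add: ddt_eq_0_iff)
  then have "p \<noteq> 0" using p by auto
  then obtain \<psi> y where \<psi>: "\<psi> \<noteq> 0" "y \<in> laurent" "ev s \<psi> = to_fract p * y"
    using laurent_multiple_in_adjoin[OF assms(1)] by blast
  have eq: "ev s \<psi> * inverse (ddt s) = ratvar ^ m * y"
    using p nz \<psi>(3) by (simp add: field_simps)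
  show ?thesis
  proof (rule finite_codim_polynomial[OF subspace_witt_sub subspace_der_adjoin _ \<psi>(1) der_adjoin_subset])
    show "witt_sub s \<subseteq> der_adjoin s" by (simp add: witt_sub_def)
    show "vf (ev s (\<psi> * q) * inverse (ddt s)) \<in> witt_sub s" for q
    proof -
      have eq': "ev s (\<psi> * q) * inverse (ddt s) = ratvar ^ m * y * ev s q"
        unfolding eq[symmetric] by (simp add: mult_ac)
      moreover have "ratvar ^ m * y * ev s q \<in> laurent"
        using \<psi>(2) assms(1) by (intro laurent_mult laurent_power laurent_ev) auto
      ultimately have "vf (ev s (\<psi> * q) * inverse (ddt s)) \<in> witt"
        unfolding eq' witt_def by blast
      moreover have "vf (ev s (\<psi> * q) * inverse (ddt s)) \<in> der_adjoin s"
        unfolding der_adjoin_def adjoin_single divide_inverse by blast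
      ultimately show ?thesis by (simp add: witt_sub_def)
    qed
  qed
qed

section \<open>The ring of multipliers of a Lie algebra of vector fields\<close>

text \<open>The Wronskian determinant of three rational functions, up to sign: the expansion along the row of
  first derivatives.\<close>

definition wronskian :: "'a::field_char_0 ratfun \<Rightarrow> 'a ratfun \<Rightarrow> 'a ratfun \<Rightarrow> 'a ratfun" where
  "wronskian u v w =
     ddt u * (v * ddt (ddt w) - w * ddt (ddt v)) +
     ddt v * (w * ddt (ddt u) - u * ddt (ddt w)) +
     ddt w * (u * ddt (ddt v) - v * ddt (ddt u))"

text \<open>The bracket of coefficients: \<open>[u \<partial>, v \<partial>] = br u v \<partial>\<close>.\<close>

abbreviation br :: "'a::field_char_0 ratfun \<Rightarrow> 'a ratfun \<Rightarrow> 'a ratfun" where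
  "br u v \<equiv> u * ddt v - v * ddt u"

text \<open>The key identity: a cyclic sum of iterated brackets is multiplication by a Wronskian.  The terms
  with derivatives of \<open>x\<close> cancel because \<open>u (br v w)\<close> and \<open>u' (br v w)\<close> both have cyclic sum zero.\<close>

lemma wronskian_identity:
  "br u (br (br v w) x) + br v (br (br w u) x) + br w (br (br u v) x) = 2 * (wronskian u v w * x)"
  unfolding wronskian_def by (simp add: ddt_add ddt_diff ddt_mult algebra_simps)

lemma wronskian_diff: "wronskian u v (w - w') = wronskian u v w - wronskian u v w'"
  and wronskian_scale: "wronskian u v (ratconst c * w) = ratconst c * wronskian u v w"
  unfolding wronskian_def by (simp_all add: ddt_diff ddt_mult algebra_simps)

lemma ratconst_multiple_if_br_0:
  assumes "br u v = 0" "u \<noteq> 0"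
  obtains c where "v = ratconst c * u"
proof -
  have "ddt (v / u) = 0" using assms by (simp add: ddt_divide mult.commute)
  then obtain c where "v / u = ratconst c" by (auto simp: ddt_eq_0_iff)
  then show ?thesis using that[of c] assms(2) by (simp add: field_simps)
qed

text \<open>Cramer's rule expresses \<open>w\<close> by \<open>u\<close> and \<open>v\<close>; the derivatives of the coefficients are multiples of the
  Wronskian, so the coefficients are constants.\<close>

lemma linear_dependence_if_wronskian_0:
  assumes "br u v \<noteq> 0" "wronskian u v w = 0"
  obtains a b where "w = ratconst a * u + ratconst b * v"
proof -
  have "ddt (br w v / br u v) = 0" "ddt (br u w / br u v) = 0"
  proof -
    have "ddt (br w v) * br u v - br w v * ddt (br u v) = v * wronskian u v w"
         "ddt (br u w) * br u v - br u w * ddt (br u v) = - (u * wronskian u v w)"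
      unfolding wronskian_def by (simp_all add: ddt_diff ddt_mult algebra_simps)
    then show "ddt (br w v / br u v) = 0" "ddt (br u w / br u v) = 0"
      using assms by (simp_all add: ddt_divide)
  qed
  then obtain a b where "br w v / br u v = ratconst a" "br u w / br u v = ratconst b"
    by (auto simp: ddt_eq_0_iff)
  then have ab: "br w v = ratconst a * br u v" "br u w = ratconst b * br u v"
    using assms(1) by (simp_all add: field_simps)
  have "br u v * w = br w v * u + br u w * v" by (simp add: algebra_simps)
  also have "\<dots> = br u v * (ratconst a * u + ratconst b * v)"
    unfolding ab by (simp add: algebra_simps)
  finally have "w = ratconst a * u + ratconst b * v" using assms(1) by simp
  then show ?thesis by (rule that)
qed

text \<open>The Laurent polynomials that multiply the vector fields in \<open>g\<close> into \<open>g\<close>.\<close>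

definition multipliers :: "'a::field_char_0 ratop set \<Rightarrow> 'a ratfun set" where
  "multipliers g = {a \<in> laurent. \<forall>f. vf f \<in> g \<longrightarrow> vf (a * f) \<in> g}"

text \<open>The field of fractions of the ring of multipliers.\<close>

definition multiplier_field :: "'a::field_char_0 ratop set \<Rightarrow> 'a ratfun set" where
  "multiplier_field g = {a / b | a b. a \<in> multipliers g \<and> b \<in> multipliers g \<and> b \<noteq> 0}"

lemma multipliers_laurent: "a \<in> multipliers g \<Longrightarrow> a \<in> laurent"
  by (simp add: multipliers_def)

lemma multipliersD: "a \<in> multipliers g \<Longrightarrow> vf f \<in> g \<Longrightarrow> vf (a * f) \<in> g"
  by (simp add: multipliers_def)

context
  fixes g :: "'a::field_char_0 ratop set"
  assumes g: "lie_subalgebra g witt"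
begin

lemma g_space: "ratop.subspace g"
  and g_bracket: "D \<in> g \<Longrightarrow> E \<in> g \<Longrightarrow> lie_bracket D E \<in> g"
  and g_witt: "g \<subseteq> witt"
  using g unfolding lie_subalgebra_def by blast+

lemma g_add: "vf u \<in> g \<Longrightarrow> vf v \<in> g \<Longrightarrow> vf (u + v) \<in> g"
  and g_diff: "vf u \<in> g \<Longrightarrow> vf v \<in> g \<Longrightarrow> vf (u - v) \<in> g"
  and g_scale: "vf u \<in> g \<Longrightarrow> vf (ratconst c * u) \<in> g"
  unfolding vf_add vf_diff vf_scale
  by (auto intro: ratop.subspace_add ratop.subspace_diff ratop.subspace_scale g_space)

lemma g_br: "vf u \<in> g \<Longrightarrow> vf v \<in> g \<Longrightarrow> vf (br u v) \<in> g"
  using g_bracket[of "vf u" "vf v"] by (simp add: lie_bracket_vf)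

lemma g_laurent: "vf u \<in> g \<Longrightarrow> u \<in> laurent"
  using g_witt by (auto simp: witt_def)

lemma g_cases:
  assumes "D \<in> g"
  obtains f where "D = vf f" "vf f \<in> g" "f \<in> laurent"
proof -
  obtain f where "D = vf f" "f \<in> laurent" using assms g_witt by (auto simp: witt_def)
  then show ?thesis using that assms by blast
qed

lemma multipliers_const: "ratconst c \<in> multipliers g"
  by (simp add: multipliers_def g_scale)

lemma multipliers_0: "0 \<in> multipliers g" and multipliers_1: "1 \<in> multipliers g"
  using multipliers_const[of 0] multipliers_const[of 1] by simp_all

lemma multipliers_add: "a \<in> multipliers g \<Longrightarrow> b \<in> multipliers g \<Longrightarrow> a + b \<in> multipliers g"
  by (simp add: multipliers_def laurent_add g_add distrib_right)

lemma multipliers_mult: "a \<in> multipliers g \<Longrightarrow> b \<in> multipliers g \<Longrightarrow> a * b \<in> multipliers g"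
  by (simp add: multipliers_def laurent_mult mult.assoc)

lemma multipliers_diff: "a \<in> multipliers g \<Longrightarrow> b \<in> multipliers g \<Longrightarrow> a - b \<in> multipliers g"
  by (simp add: multipliers_def laurent_diff g_diff left_diff_distrib)

lemma multipliers_power: "a \<in> multipliers g \<Longrightarrow> a ^ n \<in> multipliers g"
  by (induction n) (auto intro: multipliers_mult multipliers_1)

lemma multipliers_sum: "(\<And>i. i \<in> A \<Longrightarrow> f i \<in> multipliers g) \<Longrightarrow> sum f A \<in> multipliers g"
  by (induction A rule: infinite_finite_induct) (auto intro: multipliers_add multipliers_0)

text \<open>The Lie algebra acts on its ring of multipliers.\<close>

lemma multipliers_ddt:
  assumes a: "a \<in> multipliers g" and u: "vf u \<in> g"
  shows "ddt a * u \<in> multipliers g"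
proof -
  have "vf (ddt a * u * v) \<in> g" if v: "vf v \<in> g" for v
  proof -
    have "br u (a * v) - a * br u v = ddt a * u * v"
      by (simp add: ddt_mult algebra_simps)
    moreover have "vf (br u (a * v) - a * br u v) \<in> g"
      using g_diff[OF g_br[OF u multipliersD[OF a v]] multipliersD[OF a g_br[OF u v]]] .
    ultimately show ?thesis by simp
  qed
  moreover have "ddt a * u \<in> laurent"
    using a u by (intro laurent_mult laurent_ddt multipliers_laurent g_laurent)
  ultimately show ?thesis by (simp add: multipliers_def)
qed

lemma wronskian_multiplier:
  assumes "vf u \<in> g" "vf v \<in> g" "vf w \<in> g"
  shows "wronskian u v w \<in> multipliers g"
proof -
  have "vf (wronskian u v w * x) \<in> g" if x: "vf x \<in> g" for x
  proof -
    have "vf (br u (br (br v w) x) + br v (br (br w u) x) + br w (br (br u v) x)) \<in> g"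
      using assms x by (intro g_add g_br)
    then have "vf (ratconst (1 / 2) * (2 * (wronskian u v w * x))) \<in> g"
      unfolding wronskian_identity by (rule g_scale)
    moreover have "ratconst (1 / 2) * 2 = (1 :: 'a ratfun)"
    proof -
      have "ratconst (1 / 2) * ratconst 2 = (ratconst 1 :: 'a ratfun)"
        unfolding ratconst_mult[symmetric] by simp
      moreover have "ratconst 2 = (2 :: 'a ratfun)" using ratconst_of_nat[of 2] by simp
      ultimately show ?thesis by simp
    qed
    ultimately show ?thesis by (metis mult.assoc mult_1)
  qed
  moreover have "wronskian u v w \<in> laurent"
    unfolding wronskian_def using assms
    by (intro laurent_add laurent_mult laurent_diff laurent_ddt g_laurent)
  ultimately show ?thesis by (simp add: multipliers_def)
qed

text \<open>If all multipliers, in particular all Wronskians, were constant, then \<open>g\<close> would have dimension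
  at most three.\<close>

lemma nonconstant_multiplier:
  assumes inf: "infinite_dimensional g"
  obtains a where "a \<in> multipliers g" "a \<notin> range ratconst"
proof -
  have esc: "\<exists>f. vf f \<in> g \<and> vf f \<notin> ratop.span B" if "finite B" for B
    using inf that g_cases unfolding infinite_dimensional_def by (metis subsetI)
  obtain u where u: "vf u \<in> g" "vf u \<notin> ratop.span {}" using esc[of "{}"] by auto
  then have u0: "u \<noteq> 0" by (auto simp: vf_0)
  obtain v where v: "vf v \<in> g" "vf v \<notin> ratop.span {vf u}" using esc[of "{vf u}"] by auto
  have uv: "br u v \<noteq> 0"
  proof
    assume "br u v = 0"
    then obtain c where "v = ratconst c * u" using u0 by (rule ratconst_multiple_if_br_0)
    with v(2) show False by (simp add: vf_scale ratop.span_scale ratop.span_base)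
  qed
  have in_span: "vf w \<in> ratop.span {vf u, vf v}" if w: "wronskian u v w = 0" for w
  proof -
    obtain a b where "w = ratconst a * u + ratconst b * v"
      using uv w by (rule linear_dependence_if_wronskian_0)
    then show ?thesis
      by (simp add: vf_add vf_scale ratop.span_add ratop.span_scale ratop.span_base)
  qed
  obtain w where w: "vf w \<in> g" "vf w \<notin> ratop.span {vf u, vf v}" using esc[of "{vf u, vf v}"] by auto
  then have w0: "wronskian u v w \<noteq> 0" using in_span by blast
  obtain x where x: "vf x \<in> g" "vf x \<notin> ratop.span {vf u, vf v, vf w}"
    using esc[of "{vf u, vf v, vf w}"] by auto
  have "wronskian u v w \<notin> range ratconst \<or> wronskian u v x \<notin> range ratconst"
  proof (rule ccontr)
    assume "\<not> ?thesis"
    then obtain c d where cd: "wronskian u v w = ratconst c" "wronskian u v x = ratconst d" by blast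
    with w0 have "c \<noteq> 0" by auto
    then have "wronskian u v (x - ratconst (d / c) * w) = 0"
      unfolding wronskian_diff wronskian_scale cd by simp
    then have "vf (x - ratconst (d / c) * w) \<in> ratop.span {vf u, vf v, vf w}"
      using in_span ratop.span_mono[of "{vf u, vf v}" "{vf u, vf v, vf w}"] by blast
    moreover have "vf (ratconst (d / c) * w) \<in> ratop.span {vf u, vf v, vf w}"
      unfolding vf_scale by (intro ratop.span_scale ratop.span_base) simp
    ultimately have "vf (x - ratconst (d / c) * w + ratconst (d / c) * w) \<in> ratop.span {vf u, vf v, vf w}"
      unfolding vf_add by (rule ratop.span_add)
    with x(2) show False by simp
  qed
  then show ?thesis using that wronskian_multiplier[OF u(1) v(1) w(1)]
      wronskian_multiplier[OF u(1) v(1) x(1)] by blast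
qed

lemma multiplier_in_field: "a \<in> multipliers g \<Longrightarrow> a \<in> multiplier_field g"
  unfolding multiplier_field_def using multipliers_1 by force

lemma ratsubfield_multiplier_field: "ratsubfield (multiplier_field g)"
proof -
  have "x + y \<in> multiplier_field g" "x * y \<in> multiplier_field g"
    if xy: "x \<in> multiplier_field g" "y \<in> multiplier_field g" for x y
  proof -
    obtain a b where ab: "x = a / b" "a \<in> multipliers g" "b \<in> multipliers g" "b \<noteq> 0"
      using xy(1) unfolding multiplier_field_def by blast
    obtain c d where cd: "y = c / d" "c \<in> multipliers g" "d \<in> multipliers g" "d \<noteq> 0"
      using xy(2) unfolding multiplier_field_def by blast
    have "x + y = (a * d + c * b) / (b * d)" "x * y = (a * c) / (b * d)"
      using ab cd by (simp_all add: add_frac_eq)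
    moreover have "a * d + c * b \<in> multipliers g" "a * c \<in> multipliers g"
        "b * d \<in> multipliers g" "b * d \<noteq> 0"
      using ab cd by (auto intro: multipliers_add multipliers_mult)
    ultimately show "x + y \<in> multiplier_field g" "x * y \<in> multiplier_field g"
      unfolding multiplier_field_def by blast+
  qed
  moreover have "inverse x \<in> multiplier_field g" if x: "x \<in> multiplier_field g" for x
  proof (cases "x = 0")
    case False
    obtain a b where ab: "x = a / b" "a \<in> multipliers g" "b \<in> multipliers g" "b \<noteq> 0"
      using x unfolding multiplier_field_def by blast
    then have "inverse x = b / a" "a \<noteq> 0" using False by auto
    then show ?thesis using ab unfolding multiplier_field_def by blast
  qed (use x in simp)
  ultimately show ?thesis
    unfolding ratsubfield_def using multiplier_in_field multipliers_const by blast
qed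

lemma multiplier_field_ddt:
  assumes x: "x \<in> multiplier_field g" and u: "vf u \<in> g"
  shows "ddt x * u \<in> multiplier_field g"
proof -
  obtain a b where ab: "x = a / b" "a \<in> multipliers g" "b \<in> multipliers g" "b \<noteq> 0"
    using x unfolding multiplier_field_def by blast
  have "ddt x * u = ((ddt a * u) * b - a * (ddt b * u)) / (b * b)"
    using ab(4) unfolding ab(1) by (simp add: ddt_divide algebra_simps)
  moreover have "(ddt a * u) * b - a * (ddt b * u) \<in> multipliers g" "b * b \<in> multipliers g" "b * b \<noteq> 0"
    using ab u by (auto intro: multipliers_diff multipliers_mult multipliers_ddt)
  ultimately show ?thesis unfolding multiplier_field_def by blast
qed

text \<open>An element of the field of fractions that is integral over the ring of multipliers is almost
  integral: its powers have a common denominator.\<close>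

lemma common_denominator:
  assumes x: "x \<in> multiplier_field g" and a: "a \<in> multipliers g"
    and rel: "ev x p = a * x ^ j" and j: "j < degree p"
  obtains b where "b \<in> multipliers g" "b \<noteq> 0" "\<And>q. b * ev x q \<in> multipliers g"
proof -
  obtain w z where wz: "x = w / z" "w \<in> multipliers g" "z \<in> multipliers g" "z \<noteq> 0"
    using x unfolding multiplier_field_def by blast
  define N where "N = degree p"
  \<comment> \<open>\<open>z\<^sup>N\<close> clears the denominators of the powers up to the \<open>N\<close>-th, and the relation reduces the higher
    powers to smaller ones.\<close>
  define b where "b = z ^ N"
  have lc: "lead_coeff p \<noteq> 0" using j by auto
  have pow: "b * x ^ i \<in> multipliers g" for i
  proof (induction i rule: less_induct)
    case (less i)
    show ?case
    proof (cases "i \<le> N")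
      case True
      then have "b = z ^ (N - i) * z ^ i" by (simp add: b_def flip: power_add)
      then have "b * x ^ i = z ^ (N - i) * w ^ i"
        using wz(1,4) by (simp add: power_divide)
      then show ?thesis using wz by (simp add: multipliers_mult multipliers_power)
    next
      case False
      then obtain k where i: "i = N + k" by (metis le_add_diff_inverse nat_le_linear)
      have "ev x p = (\<Sum>l<Suc N. ratconst (coeff p l) * x ^ l)"
        by (rule ev_eq_sum) (auto simp: N_def coeff_eq_0)
      then have "ratconst (lead_coeff p) * x ^ N = a * x ^ j - (\<Sum>l<N. ratconst (coeff p l) * x ^ l)"
        using rel by (simp add: N_def)
      then have "b * x ^ i = ratconst (inverse (lead_coeff p)) *
          (a * (b * x ^ (j + k)) - (\<Sum>l<N. ratconst (coeff p l) * (b * x ^ (l + k))))"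
      proof -
        assume eq: "ratconst (lead_coeff p) * x ^ N = a * x ^ j - (\<Sum>l<N. ratconst (coeff p l) * x ^ l)"
        have "ratconst (lead_coeff p) * (b * x ^ i) = (ratconst (lead_coeff p) * x ^ N) * (b * x ^ k)"
          by (simp add: i power_add mult_ac)
        also have "\<dots> = a * (b * x ^ (j + k)) - (\<Sum>l<N. ratconst (coeff p l) * (b * x ^ (l + k)))"
          unfolding eq left_diff_distrib sum_distrib_right by (simp add: power_add mult_ac)
        finally show ?thesis using lc by (simp add: field_simps)
      qed
      also have "\<dots> \<in> multipliers g"
      proof -
        have "b * x ^ (l + k) \<in> multipliers g" if "l < N" for l
          using less[of "l + k"] that i by simp
        moreover from this have "b * x ^ (j + k) \<in> multipliers g" using j by (simp add: N_def)
        ultimately show ?thesis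
          by (intro multipliers_mult[OF multipliers_const] multipliers_diff multipliers_sum
              multipliers_mult[OF a]) auto
      qed
      finally show ?thesis .
    qed
  qed
  have "b * ev x q \<in> multipliers g" for q
  proof -
    have "ev x q = (\<Sum>l<Suc (degree q). ratconst (coeff q l) * x ^ l)"
      by (rule ev_eq_sum) (auto simp: coeff_eq_0)
    then have "b * ev x q = (\<Sum>l<Suc (degree q). ratconst (coeff q l) * (b * x ^ l))"
      by (simp add: sum_distrib_left mult_ac del: sum.lessThan_Suc)
    then show ?thesis
      using pow by (simp only: multipliers_sum multipliers_mult[OF multipliers_const])
  qed
  moreover have "b \<in> multipliers g" "b \<noteq> 0" using wz by (simp_all add: b_def multipliers_power)
  ultimately show ?thesis using that by blast
qed

section \<open>The two types of subalgebras\<close>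

context
  assumes inf: "infinite_dimensional g"
begin

lemma nonzero_field: obtains f where "vf f \<in> g" "f \<noteq> 0"
proof -
  have "\<not> g \<subseteq> ratop.span {}" using inf unfolding infinite_dimensional_def by blast
  then obtain D where "D \<in> g" "D \<noteq> 0" by auto
  then obtain f where "D = vf f" "vf f \<in> g" by (auto elim: g_cases)
  moreover from this have "f \<noteq> 0" using \<open>D \<noteq> 0\<close> by (auto simp: vf_0)
  ultimately show ?thesis using that by blast
qed

text \<open>If all multipliers are polynomials in \<open>s\<close>, then \<open>s\<close> is integral over the multipliers.\<close>

lemma adjoin_denominator:
  assumes s: "s \<notin> range ratconst" "s \<in> multiplier_field g" "multipliers g \<subseteq> adjoin {s}"
  obtains A b where "ev s A \<in> multipliers g" "degree A \<noteq> 0"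
    "b \<in> multipliers g" "b \<noteq> 0" "\<And>q. b * ev s q \<in> multipliers g"
proof -
  obtain a where a: "a \<in> multipliers g" "a \<notin> range ratconst"
    using nonconstant_multiplier[OF inf] by blast
  obtain A where A: "a = ev s A" using a(1) s(3) unfolding adjoin_single by blast
  have "degree A \<noteq> 0"
  proof
    assume "degree A = 0"
    then obtain c where "A = [:c:]" by (rule degree_eq_zeroE)
    then have "a = ratconst c" using A by simp
    with a(2) show False by blast
  qed
  moreover from this have "\<exists>b. b \<in> multipliers g \<and> b \<noteq> 0 \<and> (\<forall>q. b * ev s q \<in> multipliers g)"
    using common_denominator[OF s(2) a(1), of A 0] A by auto
  ultimately show ?thesis using that a(1) A by blast
qed

lemma finite_codim_witt_sub:
  assumes s: "s \<notin> range ratconst" "s \<in> multiplier_field g" "multipliers g \<subseteq> adjoin {s}"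
    and fields: "\<And>f. vf f \<in> g \<Longrightarrow> f * ddt s \<in> adjoin {s}"
  shows "has_finite_codim_in g (witt_sub s)"
proof -
  have nz: "ddt s \<noteq> 0" using s(1) by (simp add: ddt_eq_0_iff)
  obtain A b where A: "ev s A \<in> multipliers g" "degree A \<noteq> 0"
    and b: "b \<in> multipliers g" "b \<noteq> 0" "\<And>q. b * ev s q \<in> multipliers g"
    using adjoin_denominator[OF s] by metis
  obtain \<beta> where \<beta>: "b = ev s \<beta>" using b(1) s(3) unfolding adjoin_single by blast
  obtain f where f: "vf f \<in> g" "f \<noteq> 0" by (rule nonzero_field)
  obtain \<phi> where \<phi>: "f * ddt s = ev s \<phi>" using fields[OF f(1)] unfolding adjoin_single by blast
  \<comment> \<open>With \<open>a = A(s)\<close>, the space of coefficients contains \<open>b a' f\<^sup>2\<close> times every polynomial in \<open>s\<close>, and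
    \<open>b a' f\<^sup>2 = \<psi>(s) / s'\<close>.\<close>
  define \<psi> where "\<psi> = \<beta> * pderiv A * \<phi> * \<phi>"
  have "\<beta> \<noteq> 0" "\<phi> \<noteq> 0" "pderiv A \<noteq> 0"
    using b(2) \<beta> f(2) nz \<phi> A(2) by (auto simp: pderiv_eq_0_iff)
  then have \<psi>: "\<psi> \<noteq> 0" by (simp add: \<psi>_def)
  have sub: "g \<subseteq> witt_sub s"
  proof
    fix D assume D: "D \<in> g"
    then obtain h where h: "D = vf h" "vf h \<in> g" by (auto elim: g_cases)
    have "D = vf (h * ddt s / ddt s)" using nz h(1) by simp
    then have "D \<in> der_adjoin s" unfolding der_adjoin_def using fields[OF h(2)] by blast
    then show "D \<in> witt_sub s" using D g_witt by (auto simp: witt_sub_def)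
  qed
  have "vf (ev s (\<psi> * p) * inverse (ddt s)) \<in> g" for p
  proof -
    have "vf (b * ev s p * (ddt (ev s A) * f * f)) \<in> g"
      by (rule multipliersD[OF b(3) multipliersD[OF multipliers_ddt[OF A(1) f(1)] f(1)]])
    moreover have "f = ev s \<phi> * inverse (ddt s)" using \<phi> nz by (simp add: field_simps)
    then have "b * ev s p * (ddt (ev s A) * f * f) = ev s (\<psi> * p) * inverse (ddt s)"
      using nz by (simp add: \<beta> \<psi>_def ddt_ev mult_ac)
    ultimately show ?thesis by simp
  qed
  then show ?thesis
    using finite_codim_polynomial[OF g_space subspace_witt_sub sub \<psi>, of s "inverse (ddt s)"]
      der_adjoin_subset[of s] by (auto simp: witt_sub_def)
qed

text \<open>A vector field with a pole at \<open>x = 0\<close> of order \<open>e > 0\<close>, in the coordinate \<open>x\<close>, lowers the order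
  of vanishing by \<open>e + 1\<close>.  Among the multipliers whose order at \<open>x = 0\<close> is not divisible by \<open>e + 1\<close>,
  one of minimal order leads to a contradiction.\<close>

lemma no_pole:
  assumes x: "x \<notin> range ratconst" "x \<in> multiplier_field g" "multipliers g \<subseteq> adjoin {x}"
    and f: "vf f \<in> g" "f * ddt x \<in> adjoin {x, inverse x}"
  shows "f * ddt x \<in> adjoin {x}"
proof -
  have x0: "x \<noteq> 0" using x(1) by auto
  obtain h e where h: "f * ddt x = ev x h / x ^ e" "e = 0 \<or> coeff h 0 \<noteq> 0"
    using adjoin_inverse_cases[OF x0 f(2)] by blast
  show ?thesis
  proof (cases "e = 0")
    case True
    then show ?thesis unfolding h(1) adjoin_single by simp
  next
    case False
    with h(2) have h0: "poly h 0 \<noteq> 0" by (simp add: poly_0_coeff_0)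
    obtain b where b: "b \<in> multipliers g" "b \<noteq> 0" "\<And>q. b * ev x q \<in> multipliers g"
      using adjoin_denominator[OF x] by metis
    obtain \<beta> where \<beta>: "b = ev x \<beta>" using b(1) x(3) unfolding adjoin_single by blast
    then have "\<beta> \<noteq> 0" using b(2) by auto
    define P where "P j \<longleftrightarrow> (\<exists>A. A \<noteq> 0 \<and> order 0 A = j \<and> ev x A \<in> multipliers g \<and> \<not> Suc e dvd j)" for j
    \<comment> \<open>Multiplying by a power of \<open>x\<close> makes the order congruent to 1 modulo \<open>e + 1\<close>.\<close>
    have "P (order 0 \<beta> + (e * order 0 \<beta> + 1))"
      unfolding P_def
    proof (intro exI[of _ "\<beta> * monom 1 (e * order 0 \<beta> + 1)"] conjI)
      show nz: "\<beta> * monom 1 (e * order 0 \<beta> + 1) \<noteq> 0" using \<open>\<beta> \<noteq> 0\<close> by simp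
      show "order 0 (\<beta> * monom 1 (e * order 0 \<beta> + 1)) = order 0 \<beta> + (e * order 0 \<beta> + 1)"
        unfolding order_mult[OF nz] by simp
      show "ev x (\<beta> * monom 1 (e * order 0 \<beta> + 1)) \<in> multipliers g"
        using b(3) unfolding ev_mult \<beta>[symmetric] .
      have "order 0 \<beta> + (e * order 0 \<beta> + 1) = Suc e * order 0 \<beta> + 1" by simp
      then show "\<not> Suc e dvd order 0 \<beta> + (e * order 0 \<beta> + 1)"
        using False by (metis dvd_add_right_iff dvd_triv_left nat_dvd_1_iff_1 old.nat.inject One_nat_def)
    qed
    then obtain j where "P j" and min: "\<And>i. i < j \<Longrightarrow> \<not> P i"
      using exists_least_iff[of P] by blast
    then obtain A where A: "A \<noteq> 0" "order 0 A = j" "ev x A \<in> multipliers g" "\<not> Suc e dvd j"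
      unfolding P_def by blast
    have "j \<noteq> 0" using A(4) by (metis dvd_0_right)
    then have root: "poly A 0 = 0" using A(2) order_root by blast
    then have "degree A \<noteq> 0" using A(1) by (metis degree_eq_zeroE pCons_0_0 poly_const_conv)
    then have "pderiv A \<noteq> 0" by (simp add: pderiv_eq_0_iff)
    have ordA: "order 0 A = Suc (order 0 (pderiv A))"
      by (rule order_pderiv[OF A(1) root])
    obtain C where C: "ddt (ev x A) * f = ev x C" "ev x C \<in> multipliers g"
      using multipliers_ddt[OF A(3) f(1)] x(3) unfolding adjoin_single by (metis imageE subsetD)
    have "ev x (pderiv A * h) = ev x (pderiv A) * (f * ddt x) * x ^ e"
      using h(1) x0 by simp
    also have "\<dots> = ev x (monom 1 e * C)" by (simp add: ddt_ev mult_ac flip: C(1))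
    finally have eq: "pderiv A * h = monom 1 e * C" unfolding ev_inject[OF x(1)] .
    have nz: "pderiv A * h \<noteq> 0" using \<open>pderiv A \<noteq> 0\<close> h0 by auto
    then have "C \<noteq> 0" using eq by auto
    have "order 0 (pderiv A) = e + order 0 C"
      using arg_cong[OF eq, of "order 0"] order_mult[OF nz] order_mult[of "monom 1 e" C 0] nz eq
        order_0I[OF h0] by simp
    then have jC: "j = Suc e + order 0 C" using ordA A(2) by simp
    moreover have "\<not> Suc e dvd order 0 C" using A(4) jC by (metis dvd_add dvd_refl)
    ultimately have "P (order 0 C)" unfolding P_def using \<open>C \<noteq> 0\<close> C(2) by blast
    with min[of "order 0 C"] jC show ?thesis by simp
  qed
qed

lemma ev_inverse_reflect_poly:
  assumes "x \<noteq> 0"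
  shows "ev (inverse x) (reflect_poly p) = ev x p / x ^ degree p"
proof -
  have "degree (map_poly ratconst p) = degree p" by (rule degree_map_poly) simp
  then have "map_poly ratconst (reflect_poly p) = reflect_poly (map_poly ratconst p)"
    by (intro poly_eqI) (simp add: coeff_map_poly coeff_reflect_poly)
  then show ?thesis
    using assms poly_reflect_poly_nz[of "inverse x" "map_poly ratconst p"]
      \<open>degree (map_poly ratconst p) = degree p\<close>
    by (simp add: ev_def divide_inverse power_inverse mult.commute)
qed

text \<open>The case of a multiplier with poles both at \<open>0\<close> and at infinity.\<close>

lemma finite_codim_veronese:
  assumes n: "n > 0" and s: "s = ratvar ^ n"
    and KL: "multiplier_field g \<inter> laurent = adjoin {s, inverse s}"
    and A: "ev s A / s ^ m \<in> multipliers g" "coeff A 0 \<noteq> 0" "0 < m" "m < degree A"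
  shows "has_finite_codim_in g (veronese n)"
proof -
  let ?T = "adjoin {s, inverse s}"
  have s_nonconst: "s \<notin> range ratconst" unfolding s by (rule ratvar_power_nonconst[OF n])
  then have s0: "s \<noteq> 0" by auto
  have sT: "s \<in> ?T" "inverse s \<in> ?T" by (auto intro: adjoin.gen)
  then have sK: "s \<in> multiplier_field g" "inverse s \<in> multiplier_field g" and sL: "s \<in> laurent"
    using KL by auto
  have RT: "multipliers g \<subseteq> ?T"
    using multiplier_in_field multipliers_laurent unfolding KL[symmetric] by blast
  define a where "a = ev s A / s ^ m"
  have a: "a \<in> multipliers g" using A(1) by (simp add: a_def)
  \<comment> \<open>The pole of \<open>a\<close> at infinity makes \<open>s\<close> integral over the multipliers, the pole at \<open>0\<close> makes \<open>1 / s\<close>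
    integral.\<close>
  have rel1: "ev s A = a * s ^ m" using s0 by (simp add: a_def)
  obtain b1 where b1: "b1 \<in> multipliers g" "b1 \<noteq> 0" "\<And>q. b1 * ev s q \<in> multipliers g"
    using common_denominator[OF sK(1) a rel1 A(4)] by blast
  have "s ^ degree A = s ^ m * s ^ (degree A - m)" using A(4) by (simp flip: power_add)
  then have rel2: "ev (inverse s) (reflect_poly A) = a * inverse s ^ (degree A - m)"
    unfolding ev_inverse_reflect_poly[OF s0] rel1 using s0 by (simp add: divide_inverse power_inverse)
  have "degree (reflect_poly A) = degree A" using A(2) by (simp add: degree_reflect_poly_eq)
  then have "degree A - m < degree (reflect_poly A)" using A(3,4) by simp
  then obtain b2 where b2: "b2 \<in> multipliers g" "b2 \<noteq> 0" "\<And>q. b2 * ev (inverse s) q \<in> multipliers g"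
    using common_denominator[OF sK(2) a rel2] by blast
  define b where "b = b1 * b2"
  have b: "b * y \<in> multipliers g" if y: "y \<in> ?T" for y
  proof -
    obtain p k where "y = ev s p / s ^ k" using y unfolding adjoin_inverse[OF s0] by blast
    then have "b * y = (b1 * ev s p) * (b2 * ev (inverse s) (monom 1 k))"
      by (simp add: b_def divide_inverse power_inverse)
    then show ?thesis using multipliers_mult[OF b1(3) b2(3)] by (simp only:)
  qed
  have ds: "ddt s * ratvar = of_nat n * s"
    using power_minus_mult[OF n, of "ratvar :: 'a ratfun"] by (simp add: s ddt_power mult.assoc)
  have of_nat_n: "of_nat n \<noteq> (0 :: 'a ratfun)" using n by simp
  have fT: "f / ratvar \<in> ?T" if f: "vf f \<in> g" for f
  proof -
    have "ddt s * f \<in> multiplier_field g" by (rule multiplier_field_ddt[OF sK(1) f])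
    moreover have "ddt s * f \<in> laurent" by (rule laurent_mult[OF laurent_ddt[OF sL] g_laurent[OF f]])
    ultimately have "ddt s * f \<in> ?T" unfolding KL[symmetric] by blast
    then have "ratconst (inverse (of_nat n)) * (ddt s * f * inverse s) \<in> ?T"
      using adjoin.mult[OF adjoin.const adjoin.mult[OF _ sT(2)]] by blast
    moreover have "ddt s = of_nat n * s / ratvar" using ds by (simp add: field_simps)
    then have "ratconst (inverse (of_nat n)) * (ddt s * f * inverse s) = f / ratvar"
      using of_nat_n s0 by simp
    ultimately show ?thesis by simp
  qed
  have sub: "g \<subseteq> veronese n"
  proof
    fix D assume "D \<in> g"
    then obtain f where f: "D = vf f" "vf f \<in> g" by (auto elim: g_cases)
    have "D = vf (f / ratvar * ratvar)" by (simp add: f(1))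
    then show "D \<in> veronese n" unfolding veronese_def using fT[OF f(2)] s by blast
  qed
  have a_nonconst: "ddt a \<noteq> 0"
  proof
    assume "ddt a = 0"
    then obtain c where "a = ratconst c" by (auto simp: ddt_eq_0_iff)
    then have "ev s A = ev s (monom c m)" using rel1 by simp
    then have "A = monom c m" unfolding ev_inject[OF s_nonconst] .
    then show False using A(3,2) by simp
  qed
  obtain f where f: "vf f \<in> g" "f \<noteq> 0" by (rule nonzero_field)
  \<comment> \<open>The space of coefficients contains \<open>\<chi> t\<close> times every Laurent polynomial in \<open>s\<close>; up to a power of \<open>s\<close>,
    \<open>\<chi>\<close> is a polynomial in \<open>s\<close> with non-zero constant term.\<close>
  define \<chi> where "\<chi> = b * (ddt a * f) * (f / ratvar)"
  have "\<chi> \<in> ?T"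
    unfolding \<chi>_def
    by (intro adjoin.mult[OF adjoin.mult[OF subsetD[OF RT] subsetD[OF RT]] fT[OF f(1)]])
      (simp_all add: b_def b1(1) b2(1) multipliers_mult multipliers_ddt[OF a f(1)])
  moreover have \<chi>0: "\<chi> \<noteq> 0" using b1(2) b2(2) a_nonconst f(2) by (simp add: \<chi>_def b_def)
  ultimately obtain p k where p: "\<chi> = ev s p / s ^ k" unfolding adjoin_inverse[OF s0] by blast
  have "p \<noteq> 0" using p \<chi>0 by auto
  then obtain \<psi> where \<psi>: "p = [:-0, 1:] ^ order 0 p * \<psi>" "\<not> [:-0, 1:] dvd \<psi>"
    using order_decomp by blast
  have "poly \<psi> 0 \<noteq> 0" using \<psi>(2) by (simp add: poly_eq_0_iff_dvd)
  then have \<psi>0: "coeff \<psi> 0 \<noteq> 0" by (simp add: poly_0_coeff_0)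
  have "ev s p = s ^ order 0 p * ev s \<psi>"
    by (subst \<psi>(1)) (simp only: ev_mult ev_power, simp)
  then have \<chi>\<psi>: "ev s \<psi> = \<chi> * (ev s (monom 1 k) / s ^ order 0 p)"
    using p s0 by simp
  have "vf (ev s \<psi> * y * ratvar) \<in> g" if y: "y \<in> ?T" for y
  proof -
    have "ev s (monom 1 k) / s ^ order 0 p * y \<in> ?T"
      using y by (intro adjoin.mult) (auto simp: adjoin_inverse[OF s0] simp del: ev_monom)
    then have "vf (b * (ev s (monom 1 k) / s ^ order 0 p * y) * (ddt a * f * f)) \<in> g"
      by (rule multipliersD[OF b multipliersD[OF multipliers_ddt[OF a f(1)] f(1)]])
    moreover have "b * (ev s (monom 1 k) / s ^ order 0 p * y) * (ddt a * f * f) = ev s \<psi> * y * ratvar"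
      unfolding \<chi>\<psi> by (simp add: \<chi>_def mult_ac)
    ultimately show ?thesis by simp
  qed
  moreover have "ratop.subspace (veronese n :: 'a ratop set)"
  proof (rule ratop.subspaceI)
    have "0 = vf (0 * ratvar :: 'a ratfun)" by (simp add: vf_0)
    then show "0 \<in> (veronese n :: 'a ratop set)" unfolding veronese_def using adjoin_0 by blast
  next
    fix D E :: "'a ratop" assume "D \<in> veronese n" "E \<in> veronese n"
    then obtain u v where "D = vf (u * ratvar)" "E = vf (v * ratvar)" "u \<in> ?T" "v \<in> ?T"
      unfolding veronese_def s by blast
    then have "D + E = vf ((u + v) * ratvar)" "u + v \<in> ?T"
      by (simp_all add: distrib_right vf_add adjoin.add)
    then show "D + E \<in> veronese n" unfolding veronese_def s by blast
  next
    fix c and D :: "'a ratop" assume "D \<in> veronese n"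
    then obtain u where "D = vf (u * ratvar)" "u \<in> ?T" unfolding veronese_def s by blast
    then have "ratop_scale c D = vf ((ratconst c * u) * ratvar)" "ratconst c * u \<in> ?T"
      by (simp_all add: mult.assoc vf_scale adjoin.mult adjoin.const)
    then show "ratop_scale c D \<in> veronese n" unfolding veronese_def s by blast
  qed
  ultimately show ?thesis
    using finite_codim_laurent[OF g_space _ sub \<psi>0 s0, of ratvar] by (auto simp: veronese_def s)
qed

text \<open>If no multiplier has poles both at \<open>0\<close> and at infinity, then all multipliers are polynomials
  in \<open>s\<close> or all are polynomials in \<open>1 / s\<close>; otherwise a sum of two multipliers has both poles.\<close>

lemma one_sided_multipliers:
  assumes s: "s \<notin> range ratconst" and RT: "multipliers g \<subseteq> adjoin {s, inverse s}"
    and no: "\<And>A m. ev s A / s ^ m \<in> multipliers g \<Longrightarrow> coeff A 0 \<noteq> 0 \<Longrightarrow> 0 < m \<Longrightarrow> \<not> m < degree A"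
  shows "multipliers g \<subseteq> adjoin {s} \<or> multipliers g \<subseteq> adjoin {inverse s}"
proof (rule ccontr)
  assume "\<not> ?thesis"
  then obtain x y where x: "x \<in> multipliers g" "x \<notin> adjoin {s}"
    and y: "y \<in> multipliers g" "y \<notin> adjoin {inverse s}" by blast
  have s0: "s \<noteq> 0" using s by auto
  obtain A m where A: "x = ev s A / s ^ m" "m = 0 \<or> coeff A 0 \<noteq> 0"
    using adjoin_inverse_cases[OF s0] x(1) RT by blast
  have m: "m \<noteq> 0" using A(1) x(2) by (auto simp: adjoin_single)
  obtain B k where B: "y = ev s B / s ^ k" "k = 0 \<or> coeff B 0 \<noteq> 0"
    using adjoin_inverse_cases[OF s0] y(1) RT by blast
  have k: "k < degree B"
  proof (rule ccontr)
    assume "\<not> k < degree B"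
    then have "s ^ k = s ^ degree B * s ^ (k - degree B)" by (simp flip: power_add)
    then have "y = ev (inverse s) (reflect_poly B * monom 1 (k - degree B))"
      using B(1) s0 by (simp add: ev_inverse_reflect_poly divide_inverse power_inverse)
    then have "y \<in> adjoin {inverse s}" unfolding adjoin_single by (rule range_eqI)
    with y(2) show False by contradiction
  qed
  then have "k = 0" using no[of B k] B y(1) by auto
  have "degree A \<le> m" using no[of A m] A x(1) m by auto
  define C where "C = A + monom 1 m * B"
  have "x + y = ev s C / s ^ m"
    using A(1) B(1) \<open>k = 0\<close> s0 by (simp add: C_def add_divide_distrib)
  moreover have "coeff C 0 \<noteq> 0" using A(2) m by (simp add: C_def coeff_monom_mult)
  moreover have "m < degree C"
  proof -
    have "B \<noteq> 0" using k by auto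
    then have "degree (monom 1 m * B) = m + degree B"
      by (simp add: degree_mult_eq degree_monom_eq)
    then show ?thesis using \<open>degree A \<le> m\<close> k by (simp add: C_def degree_add_eq_right)
  qed
  ultimately show False using no[of C m] multipliers_add[OF x(1) y(1)] m by auto
qed

end

end

lemma finite_codim_dichotomy:
  fixes g :: "'a::{alg_closed_field, field_char_0} ratop set"
  assumes g: "lie_subalgebra g witt" and inf: "infinite_dimensional g"
  shows "(\<exists>n>0. has_finite_codim_in g (veronese n)) \<or>
         (\<exists>s\<in>laurent. s \<notin> range ratconst \<and> has_finite_codim_in g (witt_sub s))"
proof -
  let ?K = "multiplier_field g"
  obtain a where a: "a \<in> multipliers g" "a \<notin> range ratconst"
    using nonconstant_multiplier[OF g inf] by blast
  have RK: "multipliers g \<subseteq> ?K \<inter> laurent"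
    using multiplier_in_field[OF g] multipliers_laurent by blast
  have fK: "f * ddt s \<in> ?K \<inter> laurent" if "vf f \<in> g" "s \<in> ?K" "s \<in> laurent" for f s
    using multiplier_field_ddt[OF g that(2,1)] laurent_mult[OF g_laurent[OF g that(1)] laurent_ddt[OF that(3)]]
    by (simp add: mult.commute)
  have aK: "a \<in> ?K" "a \<in> laurent" using a RK by auto
  show ?thesis
  proof (rule laurent_subfield_cases[OF ratsubfield_multiplier_field[OF g] aK a(2)])
    fix s assume s: "s \<notin> range ratconst" "?K \<inter> laurent = adjoin {s}"
    have "s \<in> adjoin {s}" by (rule adjoin.gen) simp
    then have sK: "s \<in> ?K" "s \<in> laurent" using s(2) by auto
    have "multipliers g \<subseteq> adjoin {s}" using RK s(2) by simp
    moreover have "f * ddt s \<in> adjoin {s}" if "vf f \<in> g" for f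
      using fK[OF that sK] s(2) by simp
    ultimately have "has_finite_codim_in g (witt_sub s)"
      by (rule finite_codim_witt_sub[OF g inf s(1) sK(1)])
    then show ?thesis using s(1) sK(2) by blast
  next
    fix n :: nat assume n: "n > 0" "?K \<inter> laurent = adjoin {ratvar ^ n, inverse (ratvar ^ n)}"
    define s where "s = (ratvar :: 'a ratfun) ^ n"
    have KL: "?K \<inter> laurent = adjoin {s, inverse s}" using n(2) by (simp add: s_def)
    have s: "s \<notin> range ratconst" unfolding s_def by (rule ratvar_power_nonconst[OF n(1)])
    have one_sided: ?thesis
      if x: "x \<notin> range ratconst" "multipliers g \<subseteq> adjoin {x}" "adjoin {x, inverse x} = adjoin {s, inverse s}" for x
    proof -
      have "x \<in> adjoin {x, inverse x}" by (rule adjoin.gen) simp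
      then have xK: "x \<in> ?K" "x \<in> laurent" using x(3) KL by auto
      have "f * ddt x \<in> adjoin {x}" if "vf f \<in> g" for f
        using no_pole[OF g inf x(1) xK(1) x(2) that] fK[OF that xK] KL x(3) by simp
      then have "has_finite_codim_in g (witt_sub x)"
        by (rule finite_codim_witt_sub[OF g inf x(1) xK(1) x(2)])
      then show ?thesis using x(1) xK(2) by blast
    qed
    show ?thesis
    proof (cases "\<exists>A m. ev s A / s ^ m \<in> multipliers g \<and> coeff A 0 \<noteq> 0 \<and> 0 < m \<and> m < degree A")
      case True
      then show ?thesis using finite_codim_veronese[OF g inf n(1) s_def KL] n(1) by blast
    next
      case False
      have "multipliers g \<subseteq> adjoin {s} \<or> multipliers g \<subseteq> adjoin {inverse s}"
        using RK False unfolding KL by (intro one_sided_multipliers[OF g inf s]) blast+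
      moreover have "inverse s \<notin> range ratconst"
      proof
        assume "inverse s \<in> range ratconst"
        then obtain c where "inverse s = ratconst c" by blast
        then have "s = ratconst (inverse c)" by (metis inverse_inverse_eq ratconst_inverse)
        with s show False by blast
      qed
      ultimately show ?thesis using one_sided[of s] one_sided[of "inverse s"] s
        by (auto simp: insert_commute)
    qed
  qed
qed

theorem theorem9p3:
  fixes g :: "'a::{alg_closed_field, field_char_0} ratop set"
  assumes "lie_subalgebra g witt"
    and "infinite_dimensional g"
  shows "((\<exists>n>0. has_finite_codim_in g (veronese n)) \<or>
          (\<exists>s\<in>laurent. s \<notin> range ratconst \<and> has_finite_codim_in g (witt_sub s))) \<and>
         ((\<exists>n>0. has_finite_codim_in g (veronese n)) \<longrightarrow>
          (\<exists>h. lie_subalgebra h witt \<and> has_finite_codim_in h witt \<and> lie_isomorphic g h)) \<and>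
         ((\<exists>s\<in>laurent. s \<notin> range ratconst \<and> has_finite_codim_in g (witt_sub s)) \<longrightarrow>
          (\<exists>h. lie_subalgebra h witt1 \<and> has_finite_codim_in h witt1 \<and> lie_isomorphic g h))"
proof (intro conjI impI)
  show "(\<exists>n>0. has_finite_codim_in g (veronese n)) \<or>
        (\<exists>s\<in>laurent. s \<notin> range ratconst \<and> has_finite_codim_in g (witt_sub s))"
    using assms by (rule finite_codim_dichotomy)
  show "\<exists>h. lie_subalgebra h witt \<and> has_finite_codim_in h witt \<and> lie_isomorphic g h"
    if ver: "\<exists>n>0. has_finite_codim_in g (veronese n)"
  proof -
    obtain n where n: "n > 0" "has_finite_codim_in g (veronese n)" using ver by blast
    note codim = n(2)[unfolded veronese_eq_change_var[OF n(1)] witt_def]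
    show ?thesis
      unfolding witt_def
      by (rule change_var_pullback[OF ratvar_power_nonconst[OF n(1)] _ _ _ g_space[OF assms(1)] _ codim])
        (simp_all add: image_subset_iff laurent_add laurent_mult laurent_ddt g_bracket[OF assms(1)])
  qed
  show "\<exists>h. lie_subalgebra h witt1 \<and> has_finite_codim_in h witt1 \<and> lie_isomorphic g h"
    if sub: "\<exists>s\<in>laurent. s \<notin> range ratconst \<and> has_finite_codim_in g (witt_sub s)"
  proof -
    obtain s where s: "s \<in> laurent" "s \<notin> range ratconst" "has_finite_codim_in g (witt_sub s)"
      using sub by blast
    have codim: "has_finite_codim_in g (change_var s ` witt1)"
      using has_finite_codim_in_trans[OF s(3) witt_sub_finite_codim[OF s(1,2)]]
      unfolding der_adjoin_eq_change_var[OF s(2)] .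
    have ddt: "ddt f \<in> adjoin {ratvar}" if "f \<in> adjoin {ratvar}" for f :: "'a ratfun"
      using that by (auto simp: adjoin_single ddt_ev)
    show ?thesis
      unfolding witt1_def
      by (rule change_var_pullback[OF s(2) _ _ _ g_space[OF assms(1)] _ codim[unfolded witt1_def]])
        (simp_all add: image_subset_iff adjoin.const adjoin.add adjoin.mult ddt g_bracket[OF assms(1)])
  qed
qed

end
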